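(* Under the standing hypotheses (H1)–(H6) below, the adjoint of the linear relation $T_0$ in $L^2((a,b);\varrho)$ is $T_{\max}$, i.e. $T_0^\ast=T_{\max}$.
   Context: Let $-\infty\le a<b\le\infty$ and $\varrho,\varsigma,\chi$ locally finite Borel measures on $(a,b)$ with: (H1) $\varrho$ positive; (H2) $\chi$ real-valued; (H3) $\varsigma$ real-valued with $\operatorname{supp}\varsigma=(a,b)$; (H4) $\varsigma(\{x\})\chi(\{x\})=\varsigma(\{x\})\varrho(\{x\})=0$ for all $x$; (H5) for every gap $(\alpha,\beta)$ of $\operatorname{supp}\varrho$ (an open interval in the complement of $\operatorname{supp}\varrho$ with $\alpha,\beta\in\operatorname{supp}\varrho$) and every $f\in\mathfrak{D}_\tau$ with $f(\alpha-)=f(\beta+)=0$ one has $f=0$ on $(\alpha,\beta)$; (H6) $\operatorname{supp}\varrho$ has more than one point. Notation: $\int_c^x h\,d\mu=\int_{[c,x)}h\,d\mu$ for $x>c$, $0$ for $x=c$, $-\int_{[x,c)}h\,d\mu$ for $x<c$; $AC_{loc}((a,b);\mu)$ consists of the functions $f(x)=f(c)+\int_c^x h\,d\mu$ with $h\in L^1_{loc}((a,b);|\mu|)$, $h=\frac{df}{d\mu}$. $\mathfrak{D}_\tau$ is the set of $f\in AC_{loc}((a,b);\varsigma)$ for which there is $F\in AC_{loc}((a,b);\varrho)$ with $F=-\frac{df}{d\varsigma}+\int_c^{\cdot} f\,d\chi$ $|\varsigma|$-a.e.; $\tau f:=\frac{dF}{d\varrho}$. In the Hilbert space $L^2((a,b);\varrho)$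 with $\langle f,g\rangle=\int g^\ast f\,d\varrho$, let $T_{\max}=\{(f,\tau f): f\in\mathfrak{D}_\tau,\ f,\tau f\in L^2((a,b);\varrho)\}\subseteq L^2\times L^2$ (a linear relation, possibly multi-valued), and $T_0=\{(f,\tau f)\in T_{\max}: f \text{ has compact support in }(a,b)\}$. The adjoint of a linear relation $T\subseteq L^2\times L^2$ is $T^\ast=\{(f,g): \langle f,v\rangle=\langle g,u\rangle \text{ for all }(u,v)\in T\}$. *)

theory Defs
  imports "HOL-Analysis.Analysis"
begin

definition ivl :: "ereal \<Rightarrow> ereal \<Rightarrow> real set" where
  "ivl a b = {x. a < ereal x \<and> ereal x < b}"

definition locfin_pos :: "ereal \<Rightarrow> ereal \<Rightarrow> real measure \<Rightarrow> bool" where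
  "locfin_pos a b \<mu> \<longleftrightarrow> sets \<mu> = sets borel \<and> emeasure \<mu> (- ivl a b) = 0 \<and>
     (\<forall>K. compact K \<and> K \<subseteq> ivl a b \<longrightarrow> emeasure \<mu> K < \<infinity>)"

text \<open>Real-valued locally finite Borel measure on (a,b), given by its Jordan decomposition
  \<mu> = \<mu>p - \<mu>n with mutually singular positive parts; its variation is |\<mu>| = \<mu>p + \<mu>n.\<close>
definition locfin_real :: "ereal \<Rightarrow> ereal \<Rightarrow> real measure \<Rightarrow> real measure \<Rightarrow> bool" where
  "locfin_real a b \<mu>p \<mu>n \<longleftrightarrow> locfin_pos a b \<mu>p \<and> locfin_pos a b \<mu>n \<and>
     (\<exists>A \<in> sets borel. emeasure \<mu>p (- A) = 0 \<and> emeasure \<mu>n A = 0)"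

definition rmass :: "real measure \<Rightarrow> real measure \<Rightarrow> real \<Rightarrow> real" where
  "rmass \<mu>p \<mu>n x = measure \<mu>p {x} - measure \<mu>n {x}"

definition msupp :: "ereal \<Rightarrow> ereal \<Rightarrow> real measure \<Rightarrow> real set" where
  "msupp a b \<mu> = {x \<in> ivl a b. \<forall>e>0. emeasure \<mu> (ball x e) > 0}"

definition rsupp :: "ereal \<Rightarrow> ereal \<Rightarrow> real measure \<Rightarrow> real measure \<Rightarrow> real set" where
  "rsupp a b \<mu>p \<mu>n = msupp a b \<mu>p \<union> msupp a b \<mu>n"

definition L1loc :: "ereal \<Rightarrow> ereal \<Rightarrow> real measure \<Rightarrow> (real \<Rightarrow> complex) \<Rightarrow> bool" where
  "L1loc a b \<mu> h \<longleftrightarrow> (\<forall>K. compact K \<and> K \<subseteq> ivl a b \<longrightarrow> set_integrable \<mu> K h)"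

definition pint :: "real measure \<Rightarrow> real \<Rightarrow> real \<Rightarrow> (real \<Rightarrow> complex) \<Rightarrow> complex" where
  "pint \<mu> c x h = (if c < x then set_lebesgue_integral \<mu> {c..<x} h
                   else if x < c then - set_lebesgue_integral \<mu> {x..<c} h else 0)"

definition sint :: "real measure \<Rightarrow> real measure \<Rightarrow> real \<Rightarrow> real \<Rightarrow> (real \<Rightarrow> complex) \<Rightarrow> complex" where
  "sint \<mu>p \<mu>n c x h = pint \<mu>p c x h - pint \<mu>n c x h"

text \<open>f \<in> AC_loc((a,b);\<mu>) with df/d\<mu> = h (positive measure \<mu>).\<close>
definition dens_pos :: "ereal \<Rightarrow> ereal \<Rightarrow> real measure \<Rightarrow> (real \<Rightarrow> complex) \<Rightarrow> (real \<Rightarrow> complex) \<Rightarrow> bool" where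
  "dens_pos a b \<mu> f h \<longleftrightarrow> L1loc a b \<mu> h \<and>
     (\<exists>c \<in> ivl a b. \<forall>x \<in> ivl a b. f x = f c + pint \<mu> c x h)"

text \<open>f \<in> AC_loc((a,b);\<mu>) with df/d\<mu> = h (real measure \<mu> = \<mu>p - \<mu>n; h \<in> L1loc(|\<mu>|)).\<close>
definition dens_real :: "ereal \<Rightarrow> ereal \<Rightarrow> real measure \<Rightarrow> real measure \<Rightarrow>
    (real \<Rightarrow> complex) \<Rightarrow> (real \<Rightarrow> complex) \<Rightarrow> bool" where
  "dens_real a b \<mu>p \<mu>n f h \<longleftrightarrow> L1loc a b \<mu>p h \<and> L1loc a b \<mu>n h \<and>
     (\<exists>c \<in> ivl a b. \<forall>x \<in> ivl a b. f x = f c + sint \<mu>p \<mu>n c x h)"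

text \<open>tau_graph: f \<in> D_tau and g is (a version of) tau f = dF/d\<rho>, where
  F \<in> AC_loc(\<rho>) and F = - df/d\<sigma> + \<integral>_c^. f d\<chi> holds |\<sigma>|-a.e.
  Here \<sigma> = sp - sn and \<chi> = cp - cn.\<close>
definition tau_graph :: "ereal \<Rightarrow> ereal \<Rightarrow> real measure \<Rightarrow> real measure \<Rightarrow> real measure \<Rightarrow>
    real measure \<Rightarrow> real measure \<Rightarrow> (real \<Rightarrow> complex) \<Rightarrow> (real \<Rightarrow> complex) \<Rightarrow> bool" where
  "tau_graph a b \<rho> sp sn cp cn f g \<longleftrightarrow>
     (\<exists>h F c. c \<in> ivl a b \<and> dens_real a b sp sn f h \<and> dens_pos a b \<rho> F g \<and>
        (AE x in sp. x \<in> ivl a b \<longrightarrow> F x = - h x + sint cp cn c x f) \<and>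
        (AE x in sn. x \<in> ivl a b \<longrightarrow> F x = - h x + sint cp cn c x f))"

definition in_Dtau :: "ereal \<Rightarrow> ereal \<Rightarrow> real measure \<Rightarrow> real measure \<Rightarrow> real measure \<Rightarrow>
    real measure \<Rightarrow> real measure \<Rightarrow> (real \<Rightarrow> complex) \<Rightarrow> bool" where
  "in_Dtau a b \<rho> sp sn cp cn f \<longleftrightarrow> (\<exists>g. tau_graph a b \<rho> sp sn cp cn f g)"

definition L2 :: "real measure \<Rightarrow> (real \<Rightarrow> complex) \<Rightarrow> bool" where
  "L2 \<rho> f \<longleftrightarrow> f \<in> borel_measurable \<rho> \<and> integrable \<rho> (\<lambda>x. (cmod (f x))\<^sup>2)"

definition L2inner :: "real measure \<Rightarrow> (real \<Rightarrow> complex) \<Rightarrow> (real \<Rightarrow> complex) \<Rightarrow> complex" where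
  "L2inner \<rho> f g = (LINT x|\<rho>. cnj (g x) * f x)"

text \<open>Linear relations in L^2(\<rho>) are represented as sets of pairs of representatives,
  closed under \<rho>-a.e. modification.\<close>
definition Tmax :: "ereal \<Rightarrow> ereal \<Rightarrow> real measure \<Rightarrow> real measure \<Rightarrow> real measure \<Rightarrow>
    real measure \<Rightarrow> real measure \<Rightarrow> ((real \<Rightarrow> complex) \<times> (real \<Rightarrow> complex)) set" where
  "Tmax a b \<rho> sp sn cp cn = {(u, v). L2 \<rho> u \<and> L2 \<rho> v \<and>
     (\<exists>f g. tau_graph a b \<rho> sp sn cp cn f g \<and>
        (AE x in \<rho>. u x = f x) \<and> (AE x in \<rho>. v x = g x))}"

definition T0 :: "ereal \<Rightarrow> ereal \<Rightarrow> real measure \<Rightarrow> real measure \<Rightarrow> real measure \<Rightarrow>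
    real measure \<Rightarrow> real measure \<Rightarrow> ((real \<Rightarrow> complex) \<times> (real \<Rightarrow> complex)) set" where
  "T0 a b \<rho> sp sn cp cn = {(u, v). L2 \<rho> u \<and> L2 \<rho> v \<and>
     (\<exists>f g. tau_graph a b \<rho> sp sn cp cn f g \<and>
        (\<exists>K. compact K \<and> K \<subseteq> ivl a b \<and> (\<forall>x \<in> ivl a b - K. f x = 0)) \<and>
        (AE x in \<rho>. u x = f x) \<and> (AE x in \<rho>. v x = g x))}"

definition adjoint_rel :: "real measure \<Rightarrow> ((real \<Rightarrow> complex) \<times> (real \<Rightarrow> complex)) set \<Rightarrow>
    ((real \<Rightarrow> complex) \<times> (real \<Rightarrow> complex)) set" where
  "adjoint_rel \<rho> T = {(f, g). L2 \<rho> f \<and> L2 \<rho> g \<and>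
     (\<forall>(u, v) \<in> T. L2inner \<rho> f v = L2inner \<rho> g u)}"

end

theory Submission
  imports Defs
begin

text \<open>
  All five measures are written as densities with respect to their sum \<open>M\<close>, so that the equation
  \<open>\<tau> f = g\<close> becomes a first-order system \<open>df = h s dM\<close>, \<open>dh = (f q - g r) dM\<close> in which, by the fourth
  hypothesis, \<open>s\<close> has no atom in common with \<open>q\<close> or \<open>r\<close>. Integration by parts then has no jump terms
  and gives the Lagrange identity; a Picard iteration to the right together with the constancy of the
  Wronskian solves every initial value problem uniquely on the whole interval.

  The inclusion of \<open>Tmax\<close> in the adjoint is the Lagrange identity. Conversely, let \<open>(f, g)\<close> be in the
  adjoint and let \<open>ft\<close> solve \<open>\<tau> ft = g\<close>. Whenever a compactly supported \<open>v\<close> is orthogonal to two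
  independent homogeneous solutions \<open>u1\<close>, \<open>u2\<close>, it is of the form \<open>\<tau> u\<close> with \<open>u\<close> compactly supported, whence
  \<open>v\<close> is orthogonal to \<open>f - ft\<close>. By linear algebra \<open>f - ft\<close> is almost everywhere a combination of \<open>u1\<close> and \<open>u2\<close>.
\<close>

section \<open>Iterated integrals and Picard iteration\<close>

text \<open>Since integrals run over half-open intervals, solutions are left-continuous, and the
  measures may have atoms. Integration by parts therefore produces products of jumps at common
  atoms; in the Wronskian these pair \<open>s\<close> only with \<open>q\<close> or
  \<open>r\<close>. Picard iteration is explicit only to the right, where the jump at a point is
  computed from the values at that point; to the left a jump would have to be inverted. Moreover
  \<open>F\<close> is tied to \<open>df/d\<sigma>\<close> only almost everywhere, so
  \<open>h\<close> is taken to be \<open>\<integral> f d\<chi> - F\<close>, which has values at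
  points and gives the boundary terms a meaning. For elements of \<open>T0\<close> these terms must
  vanish although only \<open>f\<close> is known to have compact support; full support of \<sigma>
  carries the vanishing of \<open>f\<close> on an open interval over to \<open>h\<close>. In the
  converse inclusion, \<open>ft\<close>, \<open>u1\<close> and \<open>u2\<close> need not be square
  integrable near the endpoints, so that orthogonality makes sense only against compactly supported
  functions, and linear algebra on functionals takes the place of orthogonal complements.\<close>

locale line_measure = sigma_finite_measure M for M :: "real measure" +
  assumes sets_M[measurable_cong, simp]: "sets M = sets borel"
begin

lemma space_M[simp]: "space M = UNIV"
  using sets_eq_imp_space_eq[OF sets_M] by simp

lemma borel_measurable_M[simp]: "borel_measurable M = borel_measurable borel"
  by (rule measurable_cong_sets) simp_all

text \<open>The strict half-line matches the half-open intervals of integration. The value at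
  \<open>x\<close> never depends on the integrand at \<open>x\<close>, so that iteration stays
  explicit even when \<open>x\<close> is an atom.\<close>

abbreviation cum :: "(real \<Rightarrow> 'c::{banach, second_countable_topology}) \<Rightarrow> real \<Rightarrow> 'c" where
  "cum \<phi> x \<equiv> (LINT s:{..<x}|M. \<phi> s)"

lemma cum_measurable[measurable]:
  assumes [measurable]: "\<phi> \<in> borel_measurable borel"
  shows "cum \<phi> \<in> borel_measurable borel"
  unfolding set_lebesgue_integral_def lessThan_def by measurable

lemma cum_norm_le:
  assumes "integrable M \<phi>"
  shows "norm (cum \<phi> x) \<le> (LINT s|M. norm (\<phi> s))"
proof -
  have "norm (cum \<phi> x) \<le> (LINT s|M. norm (indicator {..<x} s *\<^sub>R \<phi> s))"
    unfolding set_lebesgue_integral_def by (rule integral_norm_bound)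
  also have "\<dots> \<le> (LINT s|M. norm (\<phi> s))"
  proof (rule integral_mono)
    show "integrable M (\<lambda>s. norm (indicator {..<x} s *\<^sub>R \<phi> s))"
      by (intro integrable_norm integrable_mult_indicator assms) simp
  qed (auto simp: assms indicator_def)
  finally show ?thesis .
qed

lemma integrable_mult_bounded:
  fixes f g :: "real \<Rightarrow> 'c::{real_normed_algebra, banach, second_countable_topology}"
  assumes "integrable M f" and [measurable]: "g \<in> borel_measurable borel"
    and B: "\<And>x. norm (g x) \<le> B"
  shows "integrable M (\<lambda>x. g x * f x)" "integrable M (\<lambda>x. f x * g x)"
proof -
  have f[measurable]: "f \<in> borel_measurable borel"
    using borel_measurable_integrable[OF assms(1)] by simp
  have "norm (g x * f x) \<le> norm (B * norm (f x))" "norm (f x * g x) \<le> norm (B * norm (f x))" for x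
  proof -
    have *: "norm (g x) * norm (f x) \<le> B * norm (f x)" "norm (f x) * norm (g x) \<le> B * norm (f x)"
      using mult_right_mono[OF B[of x], of "norm (f x)"] by (auto simp: mult.commute)
    show "norm (g x * f x) \<le> norm (B * norm (f x))" "norm (f x * g x) \<le> norm (B * norm (f x))"
      using norm_mult_ineq[of "g x" "f x"] norm_mult_ineq[of "f x" "g x"] * by (auto)
  qed
  then show "integrable M (\<lambda>x. g x * f x)" "integrable M (\<lambda>x. f x * g x)"
    by (auto intro!: Bochner_Integration.integrable_bound[of M "\<lambda>x. B * norm (f x)"] assms
        integrable_mult_right integrable_norm)
qed

text \<open>Fubini: the integral of \<open>\<phi> s * \<psi> t\<close> over the plane is split into
  the triangles \<open>s < t\<close> and \<open>t < s\<close> and the diagonal. The diagonal sees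
  only atoms and yields the jump term.\<close>

lemma cum_times_cum:
  fixes \<phi> \<psi> :: "real \<Rightarrow> 'c::{real_normed_field, banach, second_countable_topology}"
  assumes "integrable M \<phi>" "integrable M \<psi>"
  shows "integrable M (\<lambda>t. cum \<phi> t * \<psi> t)" (is ?I1)
    and "integrable M (\<lambda>t. \<phi> t * cum \<psi> t)" (is ?I2)
    and "integrable M (\<lambda>t. measure M {t} *\<^sub>R (\<phi> t * \<psi> t))" (is ?I3)
    and "integral\<^sup>L M \<phi> * integral\<^sup>L M \<psi> =
      (LINT t|M. cum \<phi> t * \<psi> t) + (LINT t|M. \<phi> t * cum \<psi> t) +
      (LINT t|M. measure M {t} *\<^sub>R (\<phi> t * \<psi> t))" (is ?E)
proof -
  have [measurable]: "\<phi> \<in> borel_measurable borel" "\<psi> \<in> borel_measurable borel"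
    using assms by (auto dest: borel_measurable_integrable)
  interpret P: pair_sigma_finite M M ..
  let ?f = "\<lambda>s t. \<phi> s * \<psi> t"
  let ?A = "{(s,t). s < t} :: (real \<times> real) set"
  let ?B = "{(s,t). t < s} :: (real \<times> real) set"
  let ?C = "{(s,t). s = t} :: (real \<times> real) set"
  have int: "integrable (M \<Otimes>\<^sub>M M) (case_prod ?f)"
  proof (rule P.Fubini_integrable)
    show "case_prod ?f \<in> borel_measurable (M \<Otimes>\<^sub>M M)" by measurable
    show "integrable M (\<lambda>x. LINT y|M. norm (case (x, y) of (s, t) \<Rightarrow> \<phi> s * \<psi> t))"
      using assms by (simp add: norm_mult)
    show "AE x in M. integrable M (\<lambda>y. case (x, y) of (s, t) \<Rightarrow> \<phi> s * \<psi> t)"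
      using assms by simp
  qed
  have m: "?A \<in> sets (M \<Otimes>\<^sub>M M)" "?B \<in> sets (M \<Otimes>\<^sub>M M)" "?C \<in> sets (M \<Otimes>\<^sub>M M)"
  proof -
    have "{p \<in> space (M \<Otimes>\<^sub>M M). fst p < snd p} \<in> sets (M \<Otimes>\<^sub>M M)"
         "{p \<in> space (M \<Otimes>\<^sub>M M). snd p < fst p} \<in> sets (M \<Otimes>\<^sub>M M)"
         "{p \<in> space (M \<Otimes>\<^sub>M M). fst p = snd p} \<in> sets (M \<Otimes>\<^sub>M M)"
      by measurable
    then show "?A \<in> sets (M \<Otimes>\<^sub>M M)" "?B \<in> sets (M \<Otimes>\<^sub>M M)" "?C \<in> sets (M \<Otimes>\<^sub>M M)"
      by (simp_all add: space_pair_measure case_prod_unfold)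
  qed
  have intA: "integrable (M \<Otimes>\<^sub>M M) (\<lambda>(s,t). indicator ?A (s,t) *\<^sub>R ?f s t)"
    and intB: "integrable (M \<Otimes>\<^sub>M M) (\<lambda>(s,t). indicator ?B (s,t) *\<^sub>R ?f s t)"
    and intC: "integrable (M \<Otimes>\<^sub>M M) (\<lambda>(s,t). indicator ?C (s,t) *\<^sub>R ?f s t)"
    using m[THEN integrable_mult_indicator[OF _ int]]
    by (simp_all add: case_prod_unfold)
  have eA: "(LINT s|M. indicator ?A (s,t) *\<^sub>R ?f s t) = cum \<phi> t * \<psi> t" for t
    unfolding set_lebesgue_integral_def integral_mult_left_zero[symmetric]
    by (intro Bochner_Integration.integral_cong refl) (auto simp: indicator_def)
  have eB: "(LINT t|M. indicator ?B (s,t) *\<^sub>R ?f s t) = \<phi> s * cum \<psi> s" for s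
    unfolding set_lebesgue_integral_def integral_mult_right_zero[symmetric]
    by (intro Bochner_Integration.integral_cong refl) (auto simp: indicator_def)
  have eC: "(LINT s|M. indicator ?C (s,t) *\<^sub>R ?f s t) = measure M {t} *\<^sub>R ?f t t" for t
  proof -
    have "(LINT s|M. indicator ?C (s,t) *\<^sub>R ?f s t) = (LINT s|M. indicator {t} s *\<^sub>R ?f t t)"
      by (intro Bochner_Integration.integral_cong refl) (auto simp: indicator_def)
    also have "\<dots> = measure M {t} *\<^sub>R ?f t t"
    proof (cases "?f t t = 0")
      \<comment> \<open>Integrability of \<open>\<phi>\<close> together with
        \<open>\<phi> t \<noteq> 0\<close> makes the mass of the point \<open>t\<close> finite, so
        the indicator is integrable and \<open>measure\<close> is its integral.\<close>
      case False
      have "integrable M (\<lambda>s. (indicator {t} s *\<^sub>R \<phi> s) / \<phi> t)"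
        by (intro integrable_divide integrable_mult_indicator assms) simp
      also have "(\<lambda>s. (indicator {t} s *\<^sub>R \<phi> s) / \<phi> t) = (\<lambda>s. indicator {t} s :: 'c)"
        using False by (auto simp: indicator_def)
      finally have "integrable M (\<lambda>s. norm (indicator {t} s :: 'c))" by (rule integrable_norm)
      then have "integrable M (indicator {t} :: real \<Rightarrow> real)"
        by (rule Bochner_Integration.integrable_bound) (auto simp: indicator_def)
      then show ?thesis by simp
    qed auto
    finally show ?thesis .
  qed
  show ?I1 using P.integrable_snd[OF intA] unfolding eA .
  show ?I2 using P.integrable_fst[OF intB] unfolding eB .
  show ?I3 using P.integrable_snd[OF intC] unfolding eC .
  have "integral\<^sup>L M \<phi> * integral\<^sup>L M \<psi> = (LINT s|M. (LINT t|M. ?f s t))"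
    by simp
  also have "\<dots> = integral\<^sup>L (M \<Otimes>\<^sub>M M) (case_prod ?f)"
    by (rule P.integral_fst[OF int])
  also have "\<dots> = integral\<^sup>L (M \<Otimes>\<^sub>M M) (\<lambda>p. (case p of (s,t) \<Rightarrow> indicator ?A (s,t) *\<^sub>R ?f s t)
     + (case p of (s,t) \<Rightarrow> indicator ?B (s,t) *\<^sub>R ?f s t)
     + (case p of (s,t) \<Rightarrow> indicator ?C (s,t) *\<^sub>R ?f s t))"
    by (intro Bochner_Integration.integral_cong refl)
      (auto simp: indicator_def split: prod.split)
  also have "\<dots> = (LINT t|M. cum \<phi> t * \<psi> t) + (LINT t|M. \<phi> t * cum \<psi> t) +
      (LINT t|M. measure M {t} *\<^sub>R (\<phi> t * \<psi> t))"
    using P.integral_snd[OF intA] P.integral_fst[OF intB] P.integral_snd[OF intC]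
    unfolding eA eB eC by (simp add: intA intB intC)
  finally show ?E .
qed

lemma integrable_restrict:
  fixes f :: "real \<Rightarrow> 'c::{banach, second_countable_topology}"
  shows "integrable M f \<Longrightarrow> A \<in> sets borel \<Longrightarrow> integrable M (\<lambda>t. indicator A t *\<^sub>R f t)"
  by (intro integrable_mult_indicator) auto

text \<open>The integral of the product of the \<open>k ti\<close> over chains
  \<open>t1 < ... < tn < x\<close>. Without atoms it would equal
  \<open>cum k x ^ n / fact n\<close>; the strict inequalities discard the diagonals, so for
  nonnegative \<open>k\<close> atoms only make it smaller.\<close>

primrec iter_cum :: "(real \<Rightarrow> real) \<Rightarrow> nat \<Rightarrow> real \<Rightarrow> real" where
  "iter_cum k 0 = (\<lambda>_. 1)"
| "iter_cum k (Suc n) = cum (\<lambda>t. k t * iter_cum k n t)"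

context
  fixes k :: "real \<Rightarrow> real"
  assumes k: "integrable M k" and k0: "\<And>t. 0 \<le> k t"
begin

lemma iter_cum_props:
  "iter_cum k n \<in> borel_measurable borel \<and>
    (\<forall>x. 0 \<le> iter_cum k n x) \<and> (\<exists>B. \<forall>x. iter_cum k n x \<le> B) \<and>
    integrable M (\<lambda>t. k t * iter_cum k n t)"
proof (induction n)
  case 0
  then show ?case using k by auto
next
  case (Suc n)
  have [measurable]: "k \<in> borel_measurable borel" "iter_cum k n \<in> borel_measurable borel"
    using borel_measurable_integrable[OF k] Suc by auto
  let ?B = "LINT s|M. norm (k s * iter_cum k n s)"
  have m[measurable]: "iter_cum k (Suc n) \<in> borel_measurable borel" by simp
  have nn: "0 \<le> iter_cum k (Suc n) x" for x
    unfolding iter_cum.simps set_lebesgue_integral_def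
    using Suc k0 by (intro integral_nonneg_AE) auto
  have b: "norm (iter_cum k (Suc n) x) \<le> ?B" for x
    using cum_norm_le[of "\<lambda>t. k t * iter_cum k n t" x] Suc by simp
  have "iter_cum k (Suc n) x \<le> ?B" for x
    using b[of x] nn[of x] by simp
  then show ?case
    using m nn integrable_mult_bounded(2)[OF k m b] by blast
qed

text \<open>In the induction step, \<open>cum k x * iter_cum k (Suc n) x\<close> is the sum of two
  triangle integrals and a nonnegative diagonal. One triangle is
  \<open>iter_cum k (Suc (Suc n)) x\<close> itself; the other is at least \<open>Suc n\<close> times
  it by the induction hypothesis.\<close>

lemma iter_cum_Suc_le: "real (Suc n) * iter_cum k (Suc n) x \<le> cum k x * iter_cum k n x"
proof (induction n arbitrary: x)
  case 0
  then show ?case by simp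
next
  case (Suc n)
  note P = iter_cum_props
  \<comment> \<open>Cutting off at \<open>x\<close> turns the values at \<open>x\<close> into total
    integrals, the form in which \<open>cum_times_cum\<close> applies, and leaves \<open>cum\<close>
    unchanged up to \<open>x\<close>.\<close>
  define \<phi> where "\<phi> t = indicator {..<x} t *\<^sub>R k t" for t
  define \<psi> where "\<psi> t = indicator {..<x} t *\<^sub>R (k t * iter_cum k n t)" for t
  have i: "integrable M \<phi>" "integrable M \<psi>"
    unfolding \<phi>_def \<psi>_def by (rule integrable_restrict; use k P in simp)+
  have c\<phi>: "cum \<phi> t = cum k t" and c\<psi>: "cum \<psi> t = iter_cum k (Suc n) t" if "t \<le> x" for t
    unfolding \<phi>_def \<psi>_def set_lebesgue_integral_def iter_cum.simps using that
    by (auto intro!: Bochner_Integration.integral_cong simp: indicator_def)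
  have I: "integral\<^sup>L M \<phi> = cum k x" "integral\<^sup>L M \<psi> = iter_cum k (Suc n) x"
    unfolding \<phi>_def \<psi>_def set_lebesgue_integral_def iter_cum.simps by (rule refl)+
  have "real (Suc (Suc n)) * iter_cum k (Suc (Suc n)) x
     = (LINT t|M. real (Suc n) * (indicator {..<x} t *\<^sub>R (k t * iter_cum k (Suc n) t))) +
       (LINT t|M. indicator {..<x} t *\<^sub>R (k t * iter_cum k (Suc n) t))"
    by (subst integral_mult_right_zero)
       (simp add: set_lebesgue_integral_def algebra_simps)
  also have "\<dots> \<le> (LINT t|M. cum \<phi> t * \<psi> t) + (LINT t|M. \<phi> t * cum \<psi> t)"
  proof (intro add_mono integral_mono)
    show "integrable M (\<lambda>t. real (Suc n) * (indicator {..<x} t *\<^sub>R (k t * iter_cum k (Suc n) t)))"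
         "integrable M (\<lambda>t. indicator {..<x} t *\<^sub>R (k t * iter_cum k (Suc n) t))"
      using P[of "Suc n"] by (auto intro!: integrable_restrict simp del: iter_cum.simps real_scaleR_def)
    show "integrable M (\<lambda>t. cum \<phi> t * \<psi> t)" "integrable M (\<lambda>t. \<phi> t * cum \<psi> t)"
      using cum_times_cum[OF i] by auto
    fix t
    show "indicator {..<x} t *\<^sub>R (k t * iter_cum k (Suc n) t) \<le> \<phi> t * cum \<psi> t"
      by (cases "t < x") (auto simp: c\<psi> \<phi>_def simp del: iter_cum.simps)
    show "real (Suc n) * (indicator {..<x} t *\<^sub>R (k t * iter_cum k (Suc n) t)) \<le> cum \<phi> t * \<psi> t"
    proof (cases "t < x")
      case True
      have "k t * (real (Suc n) * iter_cum k (Suc n) t) \<le> k t * (cum k t * iter_cum k n t)"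
        using Suc.IH[of t] k0[of t] by (rule mult_left_mono)
      then show ?thesis using True
        by (simp add: c\<phi> \<psi>_def mult_ac del: iter_cum.simps)
    qed (simp add: \<psi>_def)
  qed
  also have "\<dots> \<le> integral\<^sup>L M \<phi> * integral\<^sup>L M \<psi>"
  proof -
    have "0 \<le> (LINT t|M. measure M {t} *\<^sub>R (\<phi> t * \<psi> t))"
      using k0 P by (intro integral_nonneg_AE) (auto simp: \<phi>_def \<psi>_def)
    then show ?thesis using cum_times_cum(4)[OF i] by simp
  qed
  finally show ?case unfolding I .
qed

lemma iter_cum_le: "iter_cum k n x \<le> integral\<^sup>L M k ^ n / fact n"
proof (induction n)
  case (Suc n)
  have "cum k x \<le> integral\<^sup>L M k"
    using cum_norm_le[OF k, of x] k0 by simp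
  then have "cum k x * iter_cum k n x \<le> integral\<^sup>L M k * (integral\<^sup>L M k ^ n / fact n)"
    using Suc iter_cum_props[of n] k0 by (intro mult_mono integral_nonneg_AE) auto
  then have "real (Suc n) * iter_cum k (Suc n) x \<le> integral\<^sup>L M k ^ Suc n / fact n"
    using iter_cum_Suc_le[of n x] by simp
  then have "iter_cum k (Suc n) x \<le> (integral\<^sup>L M k ^ Suc n / fact n) / real (Suc n)"
    by (subst pos_le_divide_eq) (auto simp: mult.commute simp del: iter_cum.simps)
  then show ?case by (simp add: mult.commute del: iter_cum.simps of_nat_Suc)
qed simp

end

lemma cum_suminf:
  fixes G :: "nat \<Rightarrow> real \<Rightarrow> complex" and w :: "real \<Rightarrow> complex"
  assumes [measurable]: "\<And>n. G n \<in> borel_measurable borel" and w: "integrable M w"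
    and G: "\<And>n x. norm (G n x) \<le> b n" and b: "summable b"
  shows "cum (\<lambda>t. (\<Sum>n. G n t) * w t) x = (\<Sum>n. cum (\<lambda>t. G n t * w t) x)"
proof -
  have w'[measurable]: "w \<in> borel_measurable borel" using w by auto
  let ?f = "\<lambda>n t. indicator {..<x} t *\<^sub>R (G n t * w t)"
  have sG: "summable (\<lambda>n. norm (G n t))" for t
    by (rule summable_comparison_test[OF _ b]) (use G in auto)
  have i: "integrable M (\<lambda>t. G n t * w t)" for n
    by (rule integrable_mult_bounded(1)[OF w _ G]) simp
  have if': "integrable M (?f n)" for n
    by (intro integrable_mult_indicator i) simp
  have s1: "summable (\<lambda>n. norm (?f n t))" for t
    by (rule summable_comparison_test[OF _ summable_mult2[OF sG[of t], of "norm (w t)"]])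
      (auto simp: indicator_def norm_mult)
  have s2: "summable (\<lambda>n. LINT t|M. norm (?f n t))"
  proof (rule summable_comparison_test[OF _ summable_mult2[OF b, of "LINT t|M. norm (w t)"]], intro exI allI impI)
    fix n :: nat
    have "(LINT t|M. norm (?f n t)) \<le> (LINT t|M. b n * norm (w t))"
    proof (rule integral_mono)
      show "integrable M (\<lambda>t. norm (?f n t))" by (rule integrable_norm[OF if'])
      show "integrable M (\<lambda>t. b n * norm (w t))" by (intro integrable_mult_right integrable_norm w)
      show "norm (?f n t) \<le> b n * norm (w t)" for t
        using G[of n t] order_trans[OF norm_ge_zero G[of n t]]
        by (auto simp: indicator_def norm_mult intro: mult_right_mono)
    qed
    then show "norm (LINT t|M. norm (?f n t)) \<le> b n * (LINT t|M. norm (w t))"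
      by simp
  qed
  have sc: "summable (\<lambda>n. G n t)" for t by (rule summable_norm_cancel[OF sG])
  have "(\<lambda>t. \<Sum>n. ?f n t) = (\<lambda>t. indicator {..<x} t *\<^sub>R ((\<Sum>n. G n t) * w t))"
    by (auto simp: indicator_def suminf_mult2[OF sc])
  then show "cum (\<lambda>t. (\<Sum>n. G n t) * w t) x = (\<Sum>n. cum (\<lambda>t. G n t * w t) x)"
    using integral_suminf[OF if' AE_I2 s2] s1 unfolding set_lebesgue_integral_def by simp
qed

text \<open>Picard iteration; the \<open>n\<close>-th increment is dominated by the \<open>n\<close>-fold iterated
  integral of \<open>\<bar>s\<bar> + \<bar>q\<bar>\<close>, hence by a term of the exponential series.\<close>
lemma volterra_system_solvable:
  fixes s q p :: "real \<Rightarrow> complex"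
  assumes s: "integrable M s" and q: "integrable M q" and p: "integrable M p"
  obtains f h where "f \<in> borel_measurable borel" "h \<in> borel_measurable borel"
    "bounded (range f)" "bounded (range h)"
    "\<And>x. f x = A + cum (\<lambda>t. h t * s t) x"
    "\<And>x. h x = B + cum (\<lambda>t. f t * q t - p t) x"
proof -
  have [measurable]: "s \<in> borel_measurable borel" "q \<in> borel_measurable borel" "p \<in> borel_measurable borel"
    using s q p by auto
  define k where "k t = norm (s t) + norm (q t)" for t
  have k: "integrable M k" and k0: "0 \<le> k t" for t
    unfolding k_def using s q by auto
  note P = iter_cum_props[OF k k0]
  define C where "C = norm A + norm B + (LINT t|M. norm (p t))"
  \<comment> \<open>\<open>X n\<close> is the n-th increment, not the n-th approximation. The
    inhomogeneity \<open>p\<close> sits in the zeroth increment, so that all later ones obey a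
    homogeneous recursion; \<open>C\<close> bounds both components of the zeroth one.\<close>
  define X where "X = rec_nat (\<lambda>_::real. A, \<lambda>x. B - cum p x)
    (\<lambda>_ Y. (cum (\<lambda>t. snd Y t * s t), cum (\<lambda>t. fst Y t * q t)))"
  define F where "F n = fst (X n)" for n
  define H where "H n = snd (X n)" for n
  have F0: "F 0 = (\<lambda>_. A)" and H0: "H 0 = (\<lambda>x. B - cum p x)"
    and FS: "F (Suc n) = cum (\<lambda>t. H n t * s t)" and HS: "H (Suc n) = cum (\<lambda>t. F n t * q t)" for n
    by (simp_all add: F_def H_def X_def)
  have C0: "0 \<le> C" unfolding C_def by (simp add: integral_nonneg_AE)
  have step: "norm (cum (\<lambda>t. G t * w t) x) \<le> C * iter_cum k (Suc n) x"
    if [measurable]: "G \<in> borel_measurable borel" "w \<in> borel_measurable borel"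
      and G: "\<And>x. norm (G x) \<le> C * iter_cum k n x" and w: "\<And>t. norm (w t) \<le> k t"
      for G w :: "real \<Rightarrow> complex" and n x
  proof -
    have i: "integrable M (\<lambda>t. indicator {..<x} t *\<^sub>R (C * (k t * iter_cum k n t)))"
      using P[of n] by (intro integrable_mult_indicator integrable_mult_right) auto
    have bd: "norm (indicator {..<x} t *\<^sub>R (G t * w t)) \<le> indicator {..<x} t *\<^sub>R (C * (k t * iter_cum k n t))" for t
      using mult_mono[OF G[of t] w[of t]] P[of n] C0 by (auto simp: norm_mult indicator_def mult_ac)
    have "norm (cum (\<lambda>t. G t * w t) x) \<le> (LINT t|M. norm (indicator {..<x} t *\<^sub>R (G t * w t)))"
      unfolding set_lebesgue_integral_def by (rule integral_norm_bound)
    also have "\<dots> \<le> (LINT t|M. indicator {..<x} t *\<^sub>R (C * (k t * iter_cum k n t)))"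
    proof (rule integral_mono[OF _ i bd])
      show "integrable M (\<lambda>t. norm (indicator {..<x} t *\<^sub>R (G t * w t)))"
        by (rule Bochner_Integration.integrable_bound[OF i])
          (auto simp only: real_norm_def abs_norm_cancel intro!: AE_I2 order_trans[OF bd abs_ge_self], simp)
    qed
    also have "\<dots> = C * iter_cum k (Suc n) x"
      using set_integral_mult_right[of M "{..<x}" C "\<lambda>t. k t * iter_cum k n t"]
      unfolding set_lebesgue_integral_def by (simp add: set_lebesgue_integral_def)
    finally show ?thesis .
  qed
  have main: "F n \<in> borel_measurable borel \<and> H n \<in> borel_measurable borel \<and>
      (\<forall>x. norm (F n x) \<le> C * iter_cum k n x \<and> norm (H n x) \<le> C * iter_cum k n x)" for n
  proof (induction n)
    case 0
    have "norm (B - cum p x) \<le> C" for x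
      using norm_triangle_ineq4[of B "cum p x"] cum_norm_le[OF p, of x] norm_ge_zero[of A]
      unfolding C_def by linarith
    moreover have "norm A \<le> C" by (simp add: C_def integral_nonneg_AE)
    ultimately show ?case by (simp add: F0 H0)
  next
    case (Suc n)
    then have [measurable]: "F n \<in> borel_measurable borel" "H n \<in> borel_measurable borel" by auto
    have "norm (s t) \<le> k t" "norm (q t) \<le> k t" for t by (simp_all add: k_def)
    then show ?case unfolding FS HS
      using Suc step[of "F n" q n] step[of "H n" s n] by (auto simp del: iter_cum.simps)
  qed
  then have [measurable]: "F n \<in> borel_measurable borel" "H n \<in> borel_measurable borel" for n by auto
  define b where "b n = C * (integral\<^sup>L M k ^ n / fact n)" for n
  have bs: "summable b"
    unfolding b_def using summable_exp[of "integral\<^sup>L M k"]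
    by (intro summable_mult) (simp add: field_simps)
  have Fb: "norm (F n x) \<le> b n" and Hb: "norm (H n x) \<le> b n" for n x
    using main[of n] mult_left_mono[OF iter_cum_le[OF k k0, of n x] C0] unfolding b_def
    by (auto intro: order_trans)
  define f where "f x = (\<Sum>n. F n x)" for x
  define h where "h x = (\<Sum>n. H n x)" for x
  have sF: "summable (\<lambda>n. norm (F n x))" and sH: "summable (\<lambda>n. norm (H n x))" for x
    by (rule summable_comparison_test[OF _ bs]; use Fb Hb in auto)+
  have m[measurable]: "f \<in> borel_measurable borel" "h \<in> borel_measurable borel"
    unfolding f_def[abs_def] h_def[abs_def] by measurable
  have fb: "norm (f x) \<le> suminf b" and hb: "norm (h x) \<le> suminf b" for x
    unfolding f_def h_def
    by (rule order_trans[OF summable_norm[OF sF] suminf_le[OF Fb sF bs]],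
        rule order_trans[OF summable_norm[OF sH] suminf_le[OF Hb sH bs]])
  show thesis
  proof
    show "bounded (range f)" "bounded (range h)"
      using fb hb by (auto simp: bounded_iff)
    fix x
    have "f x = F 0 x + (\<Sum>n. F (Suc n) x)"
      unfolding f_def using suminf_split_head[OF summable_norm_cancel[OF sF[of x]]] by simp
    then show "f x = A + cum (\<lambda>t. h t * s t) x"
      unfolding h_def using cum_suminf[OF _ s Hb bs] by (simp add: F0 FS)
    have "h x = H 0 x + (\<Sum>n. H (Suc n) x)"
      unfolding h_def using suminf_split_head[OF summable_norm_cancel[OF sH[of x]]] by simp
    then have "h x = B - cum p x + cum (\<lambda>t. f t * q t) x"
      unfolding f_def using cum_suminf[OF _ q Fb bs] by (simp add: H0 HS)
    also have "cum (\<lambda>t. f t * q t - p t) x = cum (\<lambda>t. f t * q t) x - cum p x"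
    proof (rule set_integral_diff)
      show "set_integrable M {..<x} (\<lambda>t. f t * q t)"
        unfolding set_integrable_def using integrable_mult_bounded(1)[OF q m(1) fb]
        by (intro integrable_mult_indicator) auto
      show "set_integrable M {..<x} p"
        unfolding set_integrable_def using p by (intro integrable_mult_indicator) auto
    qed
    ultimately show "h x = B + cum (\<lambda>t. f t * q t - p t) x" by simp
  qed (rule m)+
qed

end

section \<open>Primitives and the first-order system\<close>

context line_measure
begin

text \<open>Formulated through increments between pairs of points, without a base point, so that the
  notion restricts to subsets and can be checked on compact subintervals.\<close>

definition primitive :: "real set \<Rightarrow> (real \<Rightarrow> complex) \<Rightarrow> (real \<Rightarrow> complex) \<Rightarrow> bool" where
  "primitive D F \<phi> \<longleftrightarrow> (\<forall>x\<in>D. \<forall>y\<in>D. x \<le> y \<longrightarrow>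
     set_integrable M {x..<y} \<phi> \<and> F y = F x + (LINT t:{x..<y}|M. \<phi> t))"

lemma primitiveD:
  assumes "primitive D F \<phi>" "x \<in> D" "y \<in> D" "x \<le> y"
  shows "set_integrable M {x..<y} \<phi>" "F y = F x + (LINT t:{x..<y}|M. \<phi> t)"
  using assms unfolding primitive_def by blast+

lemma primitive_subset: "primitive D F \<phi> \<Longrightarrow> E \<subseteq> D \<Longrightarrow> primitive E F \<phi>"
  unfolding primitive_def by blast

lemma primitive_pairI:
  assumes "\<And>x y. x \<in> D \<Longrightarrow> y \<in> D \<Longrightarrow> x \<le> y \<Longrightarrow> primitive {x..y} F \<phi>"
  shows "primitive D F \<phi>"
  unfolding primitive_def
proof (intro ballI impI)
  fix x y assume "x \<in> D" "y \<in> D" "x \<le> y"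
  then show "set_integrable M {x..<y} \<phi> \<and> F y = F x + (LINT t:{x..<y}|M. \<phi> t)"
    using primitiveD[OF assms[of x y], of x y] by auto
qed

lemma primitive_cong:
  assumes "primitive {x..y} F \<phi>" "\<And>t. x \<le> t \<Longrightarrow> t \<le> y \<Longrightarrow> F t = G t"
    "\<And>t. x \<le> t \<Longrightarrow> t < y \<Longrightarrow> \<phi> t = \<psi> t"
  shows "primitive {x..y} G \<psi>"
  unfolding primitive_def
proof (intro ballI impI)
  fix u v assume uv: "u \<in> {x..y}" "v \<in> {x..y}" "u \<le> v"
  have "set_integrable M {u..<v} \<phi> \<longleftrightarrow> set_integrable M {u..<v} \<psi>"
    by (rule set_integrable_cong) (use uv assms(3) in auto)
  moreover have "(LINT t:{u..<v}|M. \<phi> t) = (LINT t:{u..<v}|M. \<psi> t)"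
    by (rule set_lebesgue_integral_cong) (use uv assms(3) in auto)
  ultimately show "set_integrable M {u..<v} \<psi> \<and> G v = G u + (LINT t:{u..<v}|M. \<psi> t)"
    using primitiveD[OF assms(1) uv] assms(2)[of u] assms(2)[of v] uv by auto
qed

lemma primitiveI:
  assumes "\<And>x y. x \<in> D \<Longrightarrow> y \<in> D \<Longrightarrow> x \<le> y \<Longrightarrow> set_integrable M {x..<y} \<phi>"
    and "\<And>x y. x \<in> D \<Longrightarrow> y \<in> D \<Longrightarrow> x \<le> y \<Longrightarrow> F y = F x + (LINT t:{x..<y}|M. \<phi> t)"
  shows "primitive D F \<phi>"
  using assms unfolding primitive_def by blast

lemma primitive_add:
  assumes F: "primitive D F \<phi>" and G: "primitive D G \<psi>"
  shows "primitive D (\<lambda>t. F t + G t) (\<lambda>t. \<phi> t + \<psi> t)"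
proof (rule primitiveI)
  fix x y assume xy: "x \<in> D" "y \<in> D" "x \<le> y"
  note i = set_integral_add[OF primitiveD(1)[OF F xy] primitiveD(1)[OF G xy]]
  show "set_integrable M {x..<y} (\<lambda>t. \<phi> t + \<psi> t)" by (rule i(1))
  show "F y + G y = F x + G x + (LINT t:{x..<y}|M. \<phi> t + \<psi> t)"
    unfolding i(2) primitiveD(2)[OF F xy] primitiveD(2)[OF G xy] by simp
qed

lemma primitive_cmult:
  assumes F: "primitive D F \<phi>"
  shows "primitive D (\<lambda>t. c * F t) (\<lambda>t. c * \<phi> t)"
proof (rule primitiveI)
  fix x y assume xy: "x \<in> D" "y \<in> D" "x \<le> y"
  show "set_integrable M {x..<y} (\<lambda>t. c * \<phi> t)" using primitiveD(1)[OF F xy] by simp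
  show "c * F y = c * F x + (LINT t:{x..<y}|M. c * \<phi> t)"
    unfolding primitiveD(2)[OF F xy] by (simp add: distrib_left)
qed

lemma primitive_diff:
  "primitive D F \<phi> \<Longrightarrow> primitive D G \<psi> \<Longrightarrow> primitive D (\<lambda>t. F t - G t) (\<lambda>t. \<phi> t - \<psi> t)"
  using primitive_add[of D F \<phi> "\<lambda>t. (-1) * G t" "\<lambda>t. (-1) * \<psi> t"] primitive_cmult[of D G \<psi> "-1"]
  by simp

lemma primitive_cnj:
  assumes F: "primitive D F \<phi>"
  shows "primitive D (\<lambda>t. cnj (F t)) (\<lambda>t. cnj (\<phi> t))"
proof (rule primitiveI)
  fix x y assume xy: "x \<in> D" "y \<in> D" "x \<le> y"
  have eq: "(\<lambda>t. indicat_real {x..<y} t *\<^sub>R cnj (\<phi> t)) = (\<lambda>t. cnj (indicat_real {x..<y} t *\<^sub>R \<phi> t))"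
    by simp
  show "set_integrable M {x..<y} (\<lambda>t. cnj (\<phi> t))"
    using primitiveD(1)[OF F xy] unfolding set_integrable_def eq complex_integrable_cnj .
  show "cnj (F y) = cnj (F x) + (LINT t:{x..<y}|M. cnj (\<phi> t))"
    unfolding primitiveD(2)[OF F xy] set_lebesgue_integral_def eq by (simp del: complex_cnj_scaleR)
qed

text \<open>The bridge from a compact interval to \<open>cum\<close> on the whole line, where the
  Fubini identity and the norm bound are available.\<close>

lemma primitive_cum_truncated:
  assumes "primitive {x..y} F \<phi>" "x \<le> y"
  defines "\<phi>' \<equiv> \<lambda>t. indicator {x..<y} t *\<^sub>R \<phi> t"
  shows "integrable M \<phi>'" "\<And>t. t \<in> {x..y} \<Longrightarrow> F t = F x + cum \<phi>' t"
proof -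
  show "integrable M \<phi>'"
    using primitiveD(1)[OF assms(1), of x y] assms(2) by (simp add: \<phi>'_def set_integrable_def)
  fix t assume t: "t \<in> {x..y}"
  have "(LINT t:{x..<t}|M. \<phi> t) = cum \<phi>' t"
    unfolding set_lebesgue_integral_def \<phi>'_def
    by (rule Bochner_Integration.integral_cong) (use t in \<open>auto simp: indicator_def\<close>)
  then show "F t = F x + cum \<phi>' t"
    using primitiveD(2)[OF assms(1), of x t] t by simp
qed

lemma primitive_measurable:
  assumes "primitive {x..y} F \<phi>"
  shows "(\<lambda>t. indicator {x..y} t *\<^sub>R F t) \<in> borel_measurable borel"
proof (cases "x \<le> y")
  case True
  note P = primitive_cum_truncated[OF assms True]
  have [measurable]: "cum (\<lambda>t. indicator {x..<y} t *\<^sub>R \<phi> t) \<in> borel_measurable borel"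
    by (rule cum_measurable) (use borel_measurable_integrable[OF P(1)] in simp)
  have "(\<lambda>t. indicator {x..y} t *\<^sub>R F t) =
    (\<lambda>t. indicator {x..y} t *\<^sub>R (F x + cum (\<lambda>t. indicator {x..<y} t *\<^sub>R \<phi> t) t))"
    using P(2) by (intro ext) (metis indicator_simps scaleR_zero_left)
  then show ?thesis by simp
qed simp

lemma primitive_bounded:
  assumes "primitive {x..y} F \<phi>"
  obtains B where "\<And>t. norm (indicator {x..y} t *\<^sub>R F t) \<le> B"
proof (cases "x \<le> y")
  case True
  note P = primitive_cum_truncated[OF assms True]
  let ?B = "norm (F x) + (LINT s|M. norm (indicator {x..<y} s *\<^sub>R \<phi> s))"
  have "norm (indicator {x..y} t *\<^sub>R F t) \<le> ?B" for t
  proof (cases "t \<in> {x..y}")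
    case True
    then show ?thesis using P(2)[OF True] norm_triangle_ineq[of "F x" "cum (\<lambda>t. indicator {x..<y} t *\<^sub>R \<phi> t) t"] cum_norm_le[OF P(1), of t] by simp
  next
    case False
    then have "norm (indicator {x..y} t *\<^sub>R F t) = 0" by simp
    also have "0 \<le> ?B" by (intro add_nonneg_nonneg integral_nonneg_AE) auto
    finally show ?thesis .
  qed
  then show thesis by (rule that)
next
  case False
  then show thesis by (intro that[of 0]) simp
qed

lemma primitive_mult_integrable:
  fixes \<psi> :: "real \<Rightarrow> complex"
  assumes "primitive {x..y} F \<phi>" "set_integrable M A \<psi>" "A \<subseteq> {x..y}" "A \<in> sets borel"
  shows "set_integrable M A (\<lambda>t. F t * \<psi> t)"
proof -
  obtain B where B: "\<And>t. norm (indicator {x..y} t *\<^sub>R F t) \<le> B"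
    using primitive_bounded[OF assms(1)] by blast
  have "integrable M (\<lambda>t. (indicator {x..y} t *\<^sub>R F t) * (indicator A t *\<^sub>R \<psi> t))"
    by (rule integrable_mult_bounded(1)[OF _ primitive_measurable[OF assms(1)] B])
      (use assms(2) in \<open>simp add: set_integrable_def\<close>)
  also have "(\<lambda>t. (indicator {x..y} t *\<^sub>R F t) * (indicator A t *\<^sub>R \<psi> t)) =
    (\<lambda>t. indicator A t *\<^sub>R (F t * \<psi> t))"
    using assms(3) by (intro ext) (auto split: split_indicator)
  finally show ?thesis unfolding set_integrable_def .
qed

text \<open>In general \<open>cum_times_cum\<close> would add the jump product
  \<open>measure M {t} *\<^sub>R (\<phi> t * \<psi> t)\<close>; \<open>atoms\<close> removes it, and
  both factors enter with their values at \<open>t\<close>.\<close>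

lemma primitive_mult:
  assumes F: "primitive D F \<phi>" and G: "primitive D G \<psi>"
    and D: "\<And>x y. x \<in> D \<Longrightarrow> y \<in> D \<Longrightarrow> {x..y} \<subseteq> D"
    and atoms: "\<And>t. t \<in> D \<Longrightarrow> measure M {t} *\<^sub>R (\<phi> t * \<psi> t) = 0"
  shows "primitive D (\<lambda>t. F t * G t) (\<lambda>t. F t * \<psi> t + \<phi> t * G t)"
proof (rule primitiveI)
  fix x y assume xy: "x \<in> D" "y \<in> D" "x \<le> y"
  have F': "primitive {x..y} F \<phi>" and G': "primitive {x..y} G \<psi>"
    using F G D[OF xy(1,2)] by (auto intro: primitive_subset)
  note i = primitiveD(1)[OF F xy] primitiveD(1)[OF G xy]
  have sub: "{x..<y} \<subseteq> {x..y}" by auto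
  have i1: "set_integrable M {x..<y} (\<lambda>t. F t * \<psi> t)"
    by (rule primitive_mult_integrable[OF F']) (use i in auto)
  have i2: "set_integrable M {x..<y} (\<lambda>t. \<phi> t * G t)"
    using primitive_mult_integrable[OF G' i(1) sub] by (simp add: mult.commute[of "\<phi> _"])
  show "set_integrable M {x..<y} (\<lambda>t. F t * \<psi> t + \<phi> t * G t)"
    using i1 i2 by (rule set_integral_add)
  define \<phi>' where "\<phi>' = (\<lambda>t. indicator {x..<y} t *\<^sub>R \<phi> t)"
  define \<psi>' where "\<psi>' = (\<lambda>t. indicator {x..<y} t *\<^sub>R \<psi> t)"
  note P = primitive_cum_truncated[OF F' xy(3), folded \<phi>'_def]
  note Q = primitive_cum_truncated[OF G' xy(3), folded \<psi>'_def]
  have cF: "cum \<phi>' t = F t - F x" and cG: "cum \<psi>' t = G t - G x" if "t \<in> {x..y}" for t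
    using P(2)[OF that] Q(2)[OF that] by simp_all
  have I: "integral\<^sup>L M \<phi>' = F y - F x" "integral\<^sup>L M \<psi>' = G y - G x"
    using primitiveD(2)[OF F xy] primitiveD(2)[OF G xy]
    by (auto simp: \<phi>'_def \<psi>'_def set_lebesgue_integral_def)
  \<comment> \<open>\<open>cum \<phi>'\<close> starts from 0 at \<open>x\<close> instead of
    \<open>F x\<close>, and likewise for \<open>G\<close>. The resulting corrections recombine to
    \<open>F y * G y - F x * G x\<close> at the end.\<close>
  have e1: "(LINT t|M. cum \<phi>' t * \<psi>' t) = (LINT t:{x..<y}|M. F t * \<psi> t) - F x * (G y - G x)"
  proof -
    have "(LINT t|M. cum \<phi>' t * \<psi>' t) = (LINT t:{x..<y}|M. F t * \<psi> t - F x * \<psi> t)"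
      unfolding set_lebesgue_integral_def[of M "{x..<y}"]
      by (rule Bochner_Integration.integral_cong)
        (auto simp: cF \<psi>'_def indicator_def algebra_simps)
    also have "\<dots> = (LINT t:{x..<y}|M. F t * \<psi> t) - (LINT t:{x..<y}|M. F x * \<psi> t)"
      by (rule set_integral_diff(2)[OF i1]) (use i in simp)
    finally show ?thesis using primitiveD(2)[OF G xy] by simp
  qed
  have e2: "(LINT t|M. \<phi>' t * cum \<psi>' t) = (LINT t:{x..<y}|M. \<phi> t * G t) - (F y - F x) * G x"
  proof -
    have "(LINT t|M. \<phi>' t * cum \<psi>' t) = (LINT t:{x..<y}|M. \<phi> t * G t - \<phi> t * G x)"
      unfolding set_lebesgue_integral_def[of M "{x..<y}"]
      by (rule Bochner_Integration.integral_cong)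
        (auto simp: cG \<phi>'_def indicator_def algebra_simps)
    also have "\<dots> = (LINT t:{x..<y}|M. \<phi> t * G t) - (LINT t:{x..<y}|M. \<phi> t * G x)"
      by (rule set_integral_diff(2)[OF i2]) (use i in simp)
    finally show ?thesis using primitiveD(2)[OF F xy] by simp
  qed
  have e3: "(LINT t|M. measure M {t} *\<^sub>R (\<phi>' t * \<psi>' t)) = 0"
  proof -
    have "measure M {t} *\<^sub>R (\<phi>' t * \<psi>' t) = 0" for t
      using atoms[of t] subsetD[OF D[OF xy(1,2)], of t]
      by (cases "t \<in> {x..<y}") (auto simp: \<phi>'_def \<psi>'_def indicator_def)
    then show ?thesis by (intro integral_eq_zero_AE AE_I2)
  qed
  have "(F y - F x) * (G y - G x) =
     (LINT t:{x..<y}|M. F t * \<psi> t) - F x * (G y - G x) + ((LINT t:{x..<y}|M. \<phi> t * G t) - (F y - F x) * G x)"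
    using cum_times_cum(4)[OF P(1) Q(1)] unfolding I e1 e2 e3 by simp
  then show "F y * G y = F x * G x + (LINT t:{x..<y}|M. F t * \<psi> t + \<phi> t * G t)"
    unfolding set_integral_add(2)[OF i1 i2] by (simp add: algebra_simps)
qed

lemma primitive_zero_imp_const:
  assumes "primitive D F (\<lambda>_. 0)" "x \<in> D" "y \<in> D"
  shows "F x = F y"
proof -
  have "F v = F u" if "u \<in> D" "v \<in> D" "u \<le> v" for u v
    using primitiveD(2)[OF assms(1) that] by simp
  from this[of x y] this[of y x] show ?thesis using assms(2,3) by (cases "x \<le> y") auto
qed

lemma primitive_cumI:
  assumes "integrable M \<phi>" "\<And>t. F t = A + cum \<phi> t"
  shows "primitive D F \<phi>"
proof (rule primitiveI)
  fix x y :: real assume "x \<le> y"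
  show i: "set_integrable M {x..<y} \<phi>"
    unfolding set_integrable_def using assms(1) by (intro integrable_mult_indicator) auto
  have i': "set_integrable M {..<x} \<phi>"
    unfolding set_integrable_def using assms(1) by (intro integrable_mult_indicator) auto
  have "{..<y} = {..<x} \<union> {x..<y}" using \<open>x \<le> y\<close> by auto
  moreover have "(LINT t:{..<x} \<union> {x..<y}|M. \<phi> t) = cum \<phi> x + (LINT t:{x..<y}|M. \<phi> t)"
    by (rule set_integral_Un[OF _ i' i]) auto
  ultimately have "cum \<phi> y = cum \<phi> x + (LINT t:{x..<y}|M. \<phi> t)" by (rule arg_cong[THEN trans])
  then show "F y = F x + (LINT t:{x..<y}|M. \<phi> t)" using assms(2) by simp
qed

end

section \<open>Initial value problems for the first-order system\<close>

locale sl_system = line_measure M for M :: "real measure" +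
  fixes I :: "real set" and s q :: "real \<Rightarrow> complex"
  assumes I: "\<And>x y. x \<in> I \<Longrightarrow> y \<in> I \<Longrightarrow> {x..y} \<subseteq> I"
    and s_int: "\<And>x y. x \<in> I \<Longrightarrow> y \<in> I \<Longrightarrow> set_integrable M {x..<y} s"
    and q_int: "\<And>x y. x \<in> I \<Longrightarrow> y \<in> I \<Longrightarrow> set_integrable M {x..<y} q"
    and atoms_sq: "\<And>x. x \<in> I \<Longrightarrow> measure M {x} *\<^sub>R (s x * q x) = 0"
begin

text \<open>\<open>p\<close> stands for \<open>g r\<close>, the right-hand side times the density of
  \<rho>; the second clause is the part of the atom hypothesis that concerns \<sigma> and
  \<rho>.\<close>

definition admissible :: "(real \<Rightarrow> complex) \<Rightarrow> bool" where
  "admissible p \<longleftrightarrow> (\<forall>x\<in>I. \<forall>y\<in>I. set_integrable M {x..<y} p) \<and>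
     (\<forall>x\<in>I. measure M {x} *\<^sub>R (s x * p x) = 0)"

lemma admissible_0: "admissible (\<lambda>_. 0)"
  by (simp add: admissible_def set_integrable_def)

text \<open>With \<open>h\<close> in the role of \<open>df/d\<sigma>\<close>, the second equation is
  the differential of \<open>F = - h + \<integral> f d\<chi>\<close> solved for \<open>h\<close>,
  whence the signs in \<open>f q - p\<close>.\<close>

definition solves :: "real set \<Rightarrow> (real \<Rightarrow> complex) \<Rightarrow> (real \<Rightarrow> complex) \<Rightarrow> (real \<Rightarrow> complex) \<Rightarrow> bool" where
  "solves D p f h \<longleftrightarrow> primitive D f (\<lambda>t. h t * s t) \<and> primitive D h (\<lambda>t. f t * q t - p t)"

lemma solves_subset: "solves D p f h \<Longrightarrow> E \<subseteq> D \<Longrightarrow> solves E p f h"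
  unfolding solves_def by (blast intro: primitive_subset)

lemma solves_add:
  assumes "solves D p f h" "solves D p' f' h'"
  shows "solves D (\<lambda>t. p t + p' t) (\<lambda>t. f t + f' t) (\<lambda>t. h t + h' t)"
  using primitive_add[of D f "\<lambda>t. h t * s t" f' "\<lambda>t. h' t * s t"]
    primitive_add[of D h "\<lambda>t. f t * q t - p t" h' "\<lambda>t. f' t * q t - p' t"] assms
  unfolding solves_def by (simp add: algebra_simps)

lemma solves_cmult:
  assumes "solves D p f h"
  shows "solves D (\<lambda>t. c * p t) (\<lambda>t. c * f t) (\<lambda>t. c * h t)"
  using primitive_cmult[of D f "\<lambda>t. h t * s t" c] primitive_cmult[of D h "\<lambda>t. f t * q t - p t" c] assms
  unfolding solves_def by (simp add: algebra_simps)

lemma solves_diff: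
  assumes "solves D p f h" "solves D p' f' h'"
  shows "solves D (\<lambda>t. p t - p' t) (\<lambda>t. f t - f' t) (\<lambda>t. h t - h' t)"
  using solves_add[OF assms(1) solves_cmult[OF assms(2), of "-1"]] by simp

text \<open>By the product rule, the terms \<open>h1 s h2\<close> and \<open>f1 f2 q\<close> occur
  twice with opposite signs and cancel. The jump products vanish because \<open>s\<close> shares no
  atom with \<open>q\<close>, nor with an admissible \<open>p\<close>.\<close>

lemma lagrange_identity:
  assumes 1: "solves D p1 f1 h1" "admissible p1" and 2: "solves D p2 f2 h2" "admissible p2"
    and D: "\<And>x y. x \<in> D \<Longrightarrow> y \<in> D \<Longrightarrow> {x..y} \<subseteq> D" "D \<subseteq> I"
  shows "primitive D (\<lambda>t. f1 t * h2 t - f2 t * h1 t) (\<lambda>t. f2 t * p1 t - f1 t * p2 t)"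
proof -
  have "measure M {t} *\<^sub>R (h t * s t * (f t * q t - p t)) = 0" if "t \<in> D" "admissible p" for h f p t
  proof -
    have "measure M {t} *\<^sub>R (s t * q t) = 0" "measure M {t} *\<^sub>R (s t * p t) = 0"
      using atoms_sq[of t] that D by (auto simp: admissible_def)
    then show ?thesis by auto
  qed
  note * = this
  have "primitive D (\<lambda>t. f1 t * h2 t - f2 t * h1 t)
    (\<lambda>t. (f1 t * (f2 t * q t - p2 t) + h1 t * s t * h2 t) - (f2 t * (f1 t * q t - p1 t) + h2 t * s t * h1 t))"
    using assms unfolding solves_def by (intro primitive_diff primitive_mult *) auto
  then show ?thesis by (simp add: algebra_simps)
qed

text \<open>Cutting the coefficients off to \<open>{x..<y}\<close> makes them integrable on the
  whole line. Nothing remains to the left of \<open>x\<close>, so the constants \<open>A\<close> and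
  \<open>B\<close> of the Volterra system become the values at \<open>x\<close>.\<close>

lemma ivp_left_end:
  assumes xy: "x \<in> I" "y \<in> I" "x \<le> y" and p: "admissible p"
  obtains f h where "solves {x..y} p f h" "f x = A" "h x = B"
proof -
  let ?r = "\<lambda>w t. indicator {x..<y} t *\<^sub>R w t"
  have i: "integrable M (?r s)" "integrable M (?r q)" "integrable M (?r p)"
    using s_int[OF xy(1,2)] q_int[OF xy(1,2)] p xy
    by (auto simp: set_integrable_def admissible_def)
  obtain f h where m: "f \<in> borel_measurable borel" "h \<in> borel_measurable borel"
    and b: "bounded (range f)" "bounded (range h)"
    and f: "\<And>t. f t = A + cum (\<lambda>t. h t * ?r s t) t"
    and h: "\<And>t. h t = B + cum (\<lambda>t. f t * ?r q t - ?r p t) t"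
    using volterra_system_solvable[OF i] by blast
  obtain Bf Bh where B: "\<And>t. norm (f t) \<le> Bf" "\<And>t. norm (h t) \<le> Bh"
    using b by (auto simp: bounded_iff)
  have P1: "primitive {x..y} f (\<lambda>t. h t * ?r s t)"
    by (rule primitive_cumI[OF _ f]) (rule integrable_mult_bounded(1)[OF i(1) m(2) B(2)])
  have P2: "primitive {x..y} h (\<lambda>t. f t * ?r q t - ?r p t)"
    by (rule primitive_cumI[OF _ h])
      (intro Bochner_Integration.integrable_diff integrable_mult_bounded(1)[OF i(2) m(1) B(1)] i)
  have "solves {x..y} p f h"
    unfolding solves_def by (rule conjI[OF primitive_cong[OF P1] primitive_cong[OF P2]]) auto
  moreover have "cum (\<lambda>t. w t * ?r s t) x = 0" "cum (\<lambda>t. w t * ?r q t - ?r p t) x = 0" for w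
    unfolding set_lebesgue_integral_def by (rule integral_eq_zero_AE; simp add: indicator_def)+
  ultimately show thesis using that[of f h] f[of x] h[of x] by simp
qed

lemma fundamental_system:
  assumes xy: "x \<in> I" "y \<in> I" "x \<le> y"
  obtains u1 v1 u2 v2 where "solves {x..y} (\<lambda>_. 0) u1 v1" "solves {x..y} (\<lambda>_. 0) u2 v2"
    "\<And>t. t \<in> {x..y} \<Longrightarrow> u1 t * v2 t - u2 t * v1 t = 1"
proof -
  obtain u1 v1 where 1: "solves {x..y} (\<lambda>_. 0) u1 v1" "u1 x = 1" "v1 x = 0"
    using ivp_left_end[OF xy admissible_0] by blast
  obtain u2 v2 where 2: "solves {x..y} (\<lambda>_. 0) u2 v2" "u2 x = 0" "v2 x = 1"
    using ivp_left_end[OF xy admissible_0] by blast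
  have "primitive {x..y} (\<lambda>t. u1 t * v2 t - u2 t * v1 t) (\<lambda>_. 0)"
    using lagrange_identity[OF 1(1) admissible_0 2(1) admissible_0] I[OF xy(1,2)] by auto
  from primitive_zero_imp_const[OF this, of x] show thesis
    using xy 1 2 by (intro that[OF 1(1) 2(1)]) auto
qed

text \<open>The Wronskians of \<open>(f, h)\<close> with two fundamental solutions are constant and
  vanish at \<open>c\<close>, hence everywhere; as the fundamental Wronskian is 1, only the zero
  solution is left. Neither direction is preferred, so \<open>c\<close> may lie anywhere in the
  interval.\<close>

lemma homogeneous_unique:
  assumes xy: "x \<in> I" "y \<in> I" and f: "solves {x..y} (\<lambda>_. 0) f h"
    and c: "c \<in> {x..y}" "f c = 0" "h c = 0" and t: "t \<in> {x..y}"
  shows "f t = 0" "h t = 0"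
proof -
  have "x \<le> y" using t by simp
  then obtain u1 v1 u2 v2 where u1: "solves {x..y} (\<lambda>_. 0) u1 v1" and u2: "solves {x..y} (\<lambda>_. 0) u2 v2"
    and W: "\<And>t. t \<in> {x..y} \<Longrightarrow> u1 t * v2 t - u2 t * v1 t = 1"
    using fundamental_system[OF xy] by blast
  have *: "f t * v t = u t * h t" if u: "solves {x..y} (\<lambda>_. 0) u v" for u v
  proof -
    have "primitive {x..y} (\<lambda>t. f t * v t - u t * h t) (\<lambda>_. 0)"
      using lagrange_identity[OF f admissible_0 u admissible_0] I[OF xy(1,2)] by auto
    from primitive_zero_imp_const[OF this c(1) t] show ?thesis using c by simp
  qed
  note e = *[OF u1] *[OF u2]
  have "f t = f t * (u1 t * v2 t - u2 t * v1 t)" "h t = h t * (u1 t * v2 t - u2 t * v1 t)"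
    using W[OF t] by auto
  moreover have "f t * (u1 t * v2 t - u2 t * v1 t) = 0" using e by algebra
  moreover have "h t * (u1 t * v2 t - u2 t * v1 t) = 0" using e by algebra
  ultimately show "f t = 0" "h t = 0" by auto
qed

lemma solution_unique:
  assumes xy: "x \<in> I" "y \<in> I" and f: "solves {x..y} p f h" and g: "solves {x..y} p g k"
    and c: "c \<in> {x..y}" "f c = g c" "h c = k c" and t: "t \<in> {x..y}"
  shows "f t = g t" "h t = k t"
  using homogeneous_unique[OF xy, of "\<lambda>t. f t - g t" "\<lambda>t. h t - k t" c t] solves_diff[OF f g] c t by auto

text \<open>The Wronskian of the fundamental system is 1, so its transfer matrix from \<open>x\<close> to \<open>c\<close> is
  invertible and any data at \<open>c\<close> can be attained from suitable data at \<open>x\<close>.\<close>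
lemma ivp_interior:
  assumes xy: "x \<in> I" "y \<in> I" and c: "c \<in> {x..y}" and p: "admissible p"
  obtains f h where "solves {x..y} p f h" "f c = A" "h c = B"
proof -
  have le: "x \<le> y" using c by simp
  obtain u1 v1 u2 v2 where u1: "solves {x..y} (\<lambda>_. 0) u1 v1" and u2: "solves {x..y} (\<lambda>_. 0) u2 v2"
    and W: "\<And>t. t \<in> {x..y} \<Longrightarrow> u1 t * v2 t - u2 t * v1 t = 1"
    using fundamental_system[OF xy le] by blast
  obtain f h where f: "solves {x..y} p f h" using ivp_left_end[OF xy le p] by blast
  \<comment> \<open>Cramer's rule for correcting the data at \<open>c\<close>; the determinant is
    the Wronskian 1.\<close>
  define \<alpha> where "\<alpha> = (A - f c) * v2 c - u2 c * (B - h c)"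
  define \<beta> where "\<beta> = u1 c * (B - h c) - (A - f c) * v1 c"
  have "solves {x..y} p (\<lambda>t. f t + (\<alpha> * u1 t + \<beta> * u2 t)) (\<lambda>t. h t + (\<alpha> * v1 t + \<beta> * v2 t))"
    using solves_add[OF f solves_add[OF solves_cmult[OF u1, of \<alpha>] solves_cmult[OF u2, of \<beta>]]] by simp
  moreover have "f c + (\<alpha> * u1 c + \<beta> * u2 c) = A" "h c + (\<alpha> * v1 c + \<beta> * v2 c) = B"
    using W[OF c] unfolding \<alpha>_def \<beta>_def by algebra+
  ultimately show thesis by (rule that)
qed

text \<open>Every compact interval around \<open>c\<close> carries a solution with the prescribed
  data, and uniqueness makes these solutions agree on overlaps, so that they glue.\<close>

lemma ivp:
  assumes c: "c \<in> I" and p: "admissible p"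
  obtains f h where "solves I p f h" "f c = A" "h c = B"
proof -
  have "\<exists>f h. solves {x..y} p f h \<and> f c = A \<and> h c = B" if "x \<in> I" "y \<in> I" "c \<in> {x..y}" for x y
    using ivp_interior[OF that p] by metis
  then obtain F H where FH: "\<And>x y. x \<in> I \<Longrightarrow> y \<in> I \<Longrightarrow> c \<in> {x..y} \<Longrightarrow>
      solves {x..y} p (F x y) (H x y) \<and> F x y c = A \<and> H x y c = B"
    by metis
  \<comment> \<open>The smallest interval containing \<open>c\<close> and \<open>t\<close> decides
    the value at \<open>t\<close>; \<open>eq\<close> shows that any larger one gives the same
    value.\<close>
  define f where "f t = F (min t c) (max t c) t" for t
  define h where "h t = H (min t c) (max t c) t" for t
  have eq: "f t = F x y t \<and> h t = H x y t" if "x \<in> I" "y \<in> I" "c \<in> {x..y}" "t \<in> {x..y}" for x y t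
  proof -
    have tI: "min t c \<in> I" "max t c \<in> I"
      using I[OF that(1,2)] that by (auto simp: min_def max_def)
    have sub: "{min t c..max t c} \<subseteq> {x..y}" using that by auto
    show ?thesis unfolding f_def h_def
      using solution_unique[OF tI, of p "F (min t c) (max t c)" "H (min t c) (max t c)" "F x y" "H x y" c t]
        FH[OF tI] FH[OF that(1-3)] solves_subset[OF _ sub] by auto
  qed
  have "solves {x..y} p f h" if xy: "x \<in> I" "y \<in> I" "x \<le> y" for x y
  proof -
    have I': "min x c \<in> I" "max y c \<in> I" "c \<in> {min x c..max y c}"
      using xy c by (auto simp: min_def max_def)
    have S: "solves {x..y} p (F (min x c) (max y c)) (H (min x c) (max y c))"
      by (rule solves_subset[OF conjunct1[OF FH[OF I']]]) auto
    show ?thesis unfolding solves_def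
      by (rule conjI[OF S[unfolded solves_def, THEN conjunct1, THEN primitive_cong]
            S[unfolded solves_def, THEN conjunct2, THEN primitive_cong]])
        (use eq[OF I'] in \<open>auto simp: min_le_iff_disj le_max_iff_disj\<close>)
  qed
  then have "solves I p f h"
    unfolding solves_def by (blast intro: primitive_pairI)
  moreover have "f c = A" "h c = B"
    using eq[OF c c, of c] FH[OF c c] by auto
  ultimately show thesis by (rule that)
qed

end

section \<open>Locally finite measures and their densities\<close>

lemma ivl_borel[measurable]: "ivl a b \<in> sets borel"
  using borel_einterval[of a b] by (simp add: ivl_def einterval_def)

lemma ivl_interval: "x \<in> ivl a b \<Longrightarrow> y \<in> ivl a b \<Longrightarrow> {x..y} \<subseteq> ivl a b"
  unfolding ivl_def
  by (auto intro: less_le_trans[of a "ereal x"] le_less_trans[of _ "ereal y"])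

lemma ivl_exhaustion:
  assumes "a < b"
  obtains l u :: "nat \<Rightarrow> real" where "\<And>i. l i < u i" "\<And>i. l i \<in> ivl a b" "\<And>i. u i \<in> ivl a b"
    "\<And>t. t \<in> ivl a b \<Longrightarrow> eventually (\<lambda>i. l i < t \<and> t < u i) sequentially"
proof (rule einterval_Icc_approximation[OF assms])
  fix u l :: "nat \<Rightarrow> real"
  assume *: "\<And>i. l i < u i" "\<And>i. a < l i" "\<And>i. u i < b" and
    lim: "(\<lambda>i. ereal (l i)) \<longlonglongrightarrow> a" "(\<lambda>i. ereal (u i)) \<longlonglongrightarrow> b"
  have "l i \<in> ivl a b" "u i \<in> ivl a b" for i
    using *[of i] unfolding ivl_def
    by (auto intro: less_trans[of _ "ereal (u i)"] less_trans[of _ "ereal (l i)"])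
  moreover have "eventually (\<lambda>i. l i < t \<and> t < u i) sequentially" if "t \<in> ivl a b" for t
    using order_tendstoD(2)[OF lim(1), of t] order_tendstoD(1)[OF lim(2), of t] that
    by (auto simp: ivl_def eventually_conj_iff)
  ultimately show thesis by (intro that[of l u] *(1))
qed

lemma compact_subset_ivl:
  assumes "compact K" "K \<subseteq> ivl a b" "ivl a b \<noteq> {}"
  obtains x y where "x \<in> ivl a b" "y \<in> ivl a b" "x \<le> y" "K \<subseteq> {x..y}"
proof (cases "K = {}")
  case True
  moreover obtain x where "x \<in> ivl a b" using assms(3) by blast
  ultimately show thesis by (intro that[of x x]) simp_all
next
  case False
  obtain x where x: "x \<in> K" "\<forall>t\<in>K. x \<le> t"
    using compact_attains_inf[OF assms(1) False] by blast
  obtain y where y: "y \<in> K" "\<forall>t\<in>K. t \<le> y"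
    using compact_attains_sup[OF assms(1) False] by blast
  show thesis using x y assms(2) by (intro that[of x y]) auto
qed

lemma L1loc_iff_Icc:
  assumes "sets \<nu> = sets borel"
  shows "L1loc a b \<nu> h \<longleftrightarrow> (\<forall>x\<in>ivl a b. \<forall>y\<in>ivl a b. set_integrable \<nu> {x..y} h)"
proof (intro iffI ballI)
  fix x y assume "L1loc a b \<nu> h" "x \<in> ivl a b" "y \<in> ivl a b"
  then show "set_integrable \<nu> {x..y} h"
    unfolding L1loc_def by (elim allE[of _ "{x..y}"]) (simp add: ivl_interval)
next
  assume *: "\<forall>x\<in>ivl a b. \<forall>y\<in>ivl a b. set_integrable \<nu> {x..y} h"
  show "L1loc a b \<nu> h"
    unfolding L1loc_def
  proof (intro allI impI, elim conjE)
    fix K assume K: "compact K" "K \<subseteq> ivl a b"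
    show "set_integrable \<nu> K h"
    proof (cases "ivl a b = {}")
      case True
      then have "K = {}" using K(2) by simp
      then show ?thesis by simp
    next
      case False
      obtain x y where xy: "x \<in> ivl a b" "y \<in> ivl a b" "K \<subseteq> {x..y}"
        by (rule compact_subset_ivl[OF K False])
      show ?thesis
        by (rule set_integrable_subset[OF bspec[OF bspec[OF * xy(1)] xy(2)] _ xy(3)])
          (simp add: assms borel_compact K(1))
    qed
  qed
qed

lemma L1loc_Ico:
  assumes "L1loc a b \<nu> h" "sets \<nu> = sets borel" "x \<in> ivl a b" "y \<in> ivl a b"
  shows "set_integrable \<nu> {x..<y} h"
proof (rule set_integrable_subset)
  show "set_integrable \<nu> {x..y} h"
    using assms(1,3,4) unfolding L1loc_iff_Icc[OF assms(2)] by blast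
qed (auto simp: assms(2))

text \<open>Converts integrals with a base point and a sign convention into plain increments, the
  form that \<open>primitive\<close> asks for.\<close>

lemma pint_step:
  assumes h: "L1loc a b \<nu> h" "sets \<nu> = sets borel"
    and I: "c \<in> ivl a b" "x \<in> ivl a b" "y \<in> ivl a b" and "x \<le> y"
  shows "pint \<nu> c y h = pint \<nu> c x h + set_lebesgue_integral \<nu> {x..<y} h"
proof -
  define J where "J u v = set_lebesgue_integral \<nu> {u..<v} h" for u v
  have J0: "J u u = 0" for u by (simp add: J_def set_lebesgue_integral_def)
  have J: "J u w = J u v + J v w" if "u \<in> ivl a b" "v \<in> ivl a b" "w \<in> ivl a b" "u \<le> v" "v \<le> w" for u v w
  proof -
    have "{u..<w} = {u..<v} \<union> {v..<w}" using that by auto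
    moreover have "(LINT t:{u..<v} \<union> {v..<w}|\<nu>. h t) = J u v + J v w"
      unfolding J_def by (rule set_integral_Un[OF _ L1loc_Ico[OF h] L1loc_Ico[OF h]]) (use that in auto)
    ultimately show ?thesis unfolding J_def by (rule arg_cong[THEN trans])
  qed
  have p1: "pint \<nu> c z h = J c z" if "c \<le> z" for z
    using that J0 unfolding pint_def J_def[symmetric] by auto
  have p2: "pint \<nu> c z h = - J z c" if "z \<le> c" for z
    using that J0 unfolding pint_def J_def[symmetric] by auto
  consider "c \<le> x" | "x \<le> c" "c \<le> y" | "y \<le> c" by linarith
  then show ?thesis
  proof cases
    case 1
    then show ?thesis unfolding J_def[symmetric] p1[OF 1] p1[OF order_trans[OF 1 \<open>x \<le> y\<close>]]
      by (rule J[OF I]) fact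
  next
    case 2
    then show ?thesis unfolding J_def[symmetric] p1[OF 2(2)] p2[OF 2(1)] J[OF I(2,1,3) 2] by simp
  next
    case 3
    then show ?thesis unfolding J_def[symmetric] p2[OF 3] p2[OF order_trans[OF \<open>x \<le> y\<close> 3]]
        J[OF I(2,3,1) \<open>x \<le> y\<close> 3] by simp
  qed
qed

lemma pint_self[simp]: "pint \<nu> c c h = 0"
  by (simp add: pint_def)

text \<open>Iterated four times, this gives one measure dominating all five given ones.\<close>

definition msum :: "real measure \<Rightarrow> real measure \<Rightarrow> real measure" where
  "msum \<mu> \<nu> = measure_of UNIV (sets borel) (\<lambda>A. emeasure \<mu> A + emeasure \<nu> A)"

lemma sets_msum[simp]: "sets (msum \<mu> \<nu>) = sets borel"
  unfolding msum_def by (metis sets.sets_measure_of_eq space_borel)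

lemma emeasure_msum:
  assumes "sets \<mu> = sets borel" "sets \<nu> = sets borel" "A \<in> sets borel"
  shows "emeasure (msum \<mu> \<nu>) A = emeasure \<mu> A + emeasure \<nu> A"
proof (rule emeasure_measure_of[OF msum_def])
  show "sets borel \<subseteq> Pow (UNIV::real set)" by simp
  show "A \<in> sets (msum \<mu> \<nu>)" using assms by simp
  show "positive (sets (msum \<mu> \<nu>)) (\<lambda>A. emeasure \<mu> A + emeasure \<nu> A)"
    by (simp add: positive_def)
  show "countably_additive (sets (msum \<mu> \<nu>)) (\<lambda>A. emeasure \<mu> A + emeasure \<nu> A)"
  proof (rule countably_additiveI)
    fix B :: "nat \<Rightarrow> real set" assume B: "range B \<subseteq> sets (msum \<mu> \<nu>)" "disjoint_family B"
    have "(\<Sum>i. emeasure \<mu> (B i)) = emeasure \<mu> (\<Union>i. B i)" "(\<Sum>i. emeasure \<nu> (B i)) = emeasure \<nu> (\<Union>i. B i)"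
      using B assms by (auto intro!: suminf_emeasure)
    then show "(\<Sum>i. emeasure \<mu> (B i) + emeasure \<nu> (B i)) = emeasure \<mu> (\<Union>i. B i) + emeasure \<nu> (\<Union>i. B i)"
      by (subst suminf_add[symmetric]) auto
  qed
qed

lemma locfin_pos_msum:
  assumes "locfin_pos a b \<mu>" "locfin_pos a b \<nu>"
  shows "locfin_pos a b (msum \<mu> \<nu>)"
  using assms unfolding locfin_pos_def
  by (auto simp: emeasure_msum borel_compact)

lemma locfin_pos_sigma_finite:
  assumes "locfin_pos a b \<mu>" "a < b"
  shows "sigma_finite_measure \<mu>"
proof -
  note * = assms(1)[unfolded locfin_pos_def]
  obtain l u :: "nat \<Rightarrow> real" where lu: "\<And>i. l i < u i" "\<And>i. l i \<in> ivl a b" "\<And>i. u i \<in> ivl a b"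
    "\<And>t. t \<in> ivl a b \<Longrightarrow> eventually (\<lambda>i. l i < t \<and> t < u i) sequentially"
    by (rule ivl_exhaustion[OF assms(2)], rule that)
  have cover: "ivl a b \<subseteq> (\<Union>i. {l i..u i})"
  proof
    fix t assume "t \<in> ivl a b"
    then obtain i where "l i < t \<and> t < u i"
      using eventually_happens'[OF sequentially_bot lu(4)] by blast
    then show "t \<in> (\<Union>i. {l i..u i})" by (intro UN_I[of i]) auto
  qed
  have sp: "space \<mu> = UNIV" using * sets_eq_imp_space_eq[of \<mu> borel] by simp
  have fin: "emeasure \<mu> {l i..u i} < \<infinity>" for i
    using * ivl_interval[OF lu(2)[of i] lu(3)[of i]] by (simp add: compact_Icc)
  let ?A = "insert (- ivl a b) (range (\<lambda>i. {l i..u i}))"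
  show ?thesis
  proof (intro sigma_finite_measure.intro exI[of _ ?A] conjI ballI)
    show "countable ?A" by simp
    show "?A \<subseteq> sets \<mu>" using * by auto
    show "\<Union>?A = space \<mu>" unfolding sp using cover by auto
    show "emeasure \<mu> B \<noteq> \<infinity>" if "B \<in> ?A" for B
      using that fin * by (auto simp: less_top)
  qed
qed

text \<open>Sigma-finiteness of \<open>\<nu>\<close> makes the Radon-Nikodym derivative finite
  almost everywhere, so that it has a real-valued version.\<close>

lemma locfin_pos_density:
  assumes \<mu>: "locfin_pos a b \<mu>" and \<nu>: "locfin_pos a b \<nu>" and "a < b"
    and ac: "\<And>A. A \<in> sets borel \<Longrightarrow> emeasure \<mu> A = 0 \<Longrightarrow> emeasure \<nu> A = 0"
  obtains d :: "real \<Rightarrow> real" where "d \<in> borel_measurable borel" "\<And>x. 0 \<le> d x" "\<nu> = density \<mu> d"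
proof -
  interpret \<mu>: sigma_finite_measure \<mu> by (rule locfin_pos_sigma_finite) fact+
  have sf: "sigma_finite_measure \<nu>" by (rule locfin_pos_sigma_finite) fact+
  have sets: "sets \<mu> = sets borel" "sets \<nu> = sets borel" using \<mu> \<nu> by (auto simp: locfin_pos_def)
  have ac': "absolutely_continuous \<mu> \<nu>" "sets \<nu> = sets \<mu>"
    unfolding absolutely_continuous_def using ac sets by (auto simp: null_sets_def)
  define d where "d x = enn2real (RN_deriv \<mu> \<nu> x)" for x
  have m: "RN_deriv \<mu> \<nu> \<in> borel_measurable \<mu>" by simp
  have "AE x in \<mu>. RN_deriv \<mu> \<nu> x = ennreal (d x)"
    using \<mu>.RN_deriv_finite[OF sf ac'] by eventually_elim (simp add: d_def less_top)
  then have "density \<mu> d = density \<mu> (RN_deriv \<mu> \<nu>)"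
    by (intro density_cong) (auto simp: d_def)
  also have "\<dots> = \<nu>" by (rule \<mu>.density_RN_deriv[OF ac'])
  finally have "\<nu> = density \<mu> d" ..
  moreover have "d \<in> borel_measurable borel"
    using m unfolding measurable_cong_sets[OF sets(1) refl] d_def[abs_def] by measurable
  ultimately show thesis by (intro that[of d]) (auto simp: d_def)
qed

context line_measure
begin

lemma density_set_integrable:
  fixes h :: "real \<Rightarrow> complex" and d :: "real \<Rightarrow> real"
  assumes h: "set_integrable (density M d) A h" and [measurable]: "d \<in> borel_measurable borel"
    and d0: "\<And>x. 0 \<le> d x"
  shows "set_integrable M A (\<lambda>t. h t * d t)"
    and "(LINT t:A|density M d. h t) = (LINT t:A|M. h t * d t)"
proof -
  have m: "(\<lambda>t. indicator A t *\<^sub>R h t) \<in> borel_measurable M"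
    using borel_measurable_integrable[OF h[unfolded set_integrable_def]] by simp
  have e: "(\<lambda>t. d t *\<^sub>R (indicator A t *\<^sub>R h t)) = (\<lambda>t. indicator A t *\<^sub>R (h t * d t))"
    by (auto simp: scaleR_conv_of_real)
  show "set_integrable M A (\<lambda>t. h t * d t)"
    using h integrable_density[OF m, of d] d0 unfolding set_integrable_def e by simp
  show "(LINT t:A|density M d. h t) = (LINT t:A|M. h t * d t)"
    using integral_density[OF m, of d] d0 unfolding set_lebesgue_integral_def e by simp
qed

text \<open>Measurability of \<open>h\<close> has to be supplied separately: where \<open>d\<close>
  vanishes, the product with \<open>d\<close> carries no information about \<open>h\<close>.\<close>

lemma set_integrable_densityI:
  fixes h :: "real \<Rightarrow> complex" and d :: "real \<Rightarrow> real"
  assumes h: "set_integrable M A (\<lambda>t. h t * d t)" and m: "(\<lambda>t. indicator A t *\<^sub>R h t) \<in> borel_measurable borel"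
    and [measurable]: "d \<in> borel_measurable borel" and d0: "\<And>x. 0 \<le> d x"
  shows "set_integrable (density M d) A h"
proof -
  have e: "(\<lambda>t. d t *\<^sub>R (indicator A t *\<^sub>R h t)) = (\<lambda>t. indicator A t *\<^sub>R (h t * d t))"
    by (auto simp: scaleR_conv_of_real)
  show ?thesis
    using h integrable_density[of "\<lambda>t. indicator A t *\<^sub>R h t" M d] m d0 unfolding set_integrable_def e by simp
qed

end

section \<open>The equation in terms of densities\<close>

text \<open>\<open>singular\<close> expresses the Jordan decomposition of \<sigma>: almost
  everywhere, \<open>s x = 0\<close> forces both \<open>sp' x\<close> and \<open>sn' x\<close> to
  vanish, so the null sets of the variation can be read off \<open>s\<close>.\<close>

locale sl_measures = line_measure M for M :: "real measure" +
  fixes a b :: ereal and r sp' sn' cp' cn' :: "real \<Rightarrow> real"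
  assumes ab: "a < b"
    and meas[measurable]: "r \<in> borel_measurable borel" "sp' \<in> borel_measurable borel"
      "sn' \<in> borel_measurable borel" "cp' \<in> borel_measurable borel" "cn' \<in> borel_measurable borel"
    and nonneg: "0 \<le> r x" "0 \<le> sp' x" "0 \<le> sn' x" "0 \<le> cp' x" "0 \<le> cn' x"
    and locint: "x \<in> ivl a b \<Longrightarrow> y \<in> ivl a b \<Longrightarrow> set_integrable M {x..y} r"
      "x \<in> ivl a b \<Longrightarrow> y \<in> ivl a b \<Longrightarrow> set_integrable M {x..y} sp'"
      "x \<in> ivl a b \<Longrightarrow> y \<in> ivl a b \<Longrightarrow> set_integrable M {x..y} sn'"
      "x \<in> ivl a b \<Longrightarrow> y \<in> ivl a b \<Longrightarrow> set_integrable M {x..y} cp'"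
      "x \<in> ivl a b \<Longrightarrow> y \<in> ivl a b \<Longrightarrow> set_integrable M {x..y} cn'"
    and null_outside: "AE x in M. x \<in> ivl a b"
    and singular: "AE x in M. sp' x = 0 \<or> sn' x = 0"
    and atoms_sc: "x \<in> ivl a b \<Longrightarrow> measure M {x} * ((sp' x - sn' x) * (cp' x - cn' x)) = 0"
    and atoms_sr: "x \<in> ivl a b \<Longrightarrow> measure M {x} * ((sp' x - sn' x) * r x) = 0"
    and full_support: "x \<in> ivl a b \<Longrightarrow> 0 < e \<Longrightarrow> \<not> (AE t in M. t \<in> ball x e \<longrightarrow> sp' t = 0 \<and> sn' t = 0)"
begin

abbreviation "\<rho> \<equiv> density M r"
abbreviation "sp \<equiv> density M sp'"
abbreviation "sn \<equiv> density M sn'"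
abbreviation "cp \<equiv> density M cp'"
abbreviation "cn \<equiv> density M cn'"
abbreviation "s \<equiv> \<lambda>x. complex_of_real (sp' x - sn' x)"
abbreviation "q \<equiv> \<lambda>x. complex_of_real (cp' x - cn' x)"

lemma of_real_integrable:
  fixes d :: "real \<Rightarrow> real"
  assumes "set_integrable M {x..y} d"
  shows "set_integrable M {x..<y} (\<lambda>t. complex_of_real (d t))"
proof -
  have "set_integrable M {x..<y} d"
    by (rule set_integrable_subset[OF assms]) auto
  then have "integrable M (\<lambda>t. complex_of_real (indicator {x..<y} t *\<^sub>R d t))"
    unfolding set_integrable_def by (rule integrable_of_real)
  then show ?thesis unfolding set_integrable_def by (simp add: scaleR_conv_of_real)
qed

lemma coeff_integrable:
  assumes "x \<in> ivl a b" "y \<in> ivl a b"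
  shows "set_integrable M {x..<y} (\<lambda>t. complex_of_real (r t))"
    "set_integrable M {x..<y} (\<lambda>t. complex_of_real (sp' t))"
    "set_integrable M {x..<y} (\<lambda>t. complex_of_real (sn' t))"
    "set_integrable M {x..<y} (\<lambda>t. complex_of_real (cp' t))"
    "set_integrable M {x..<y} (\<lambda>t. complex_of_real (cn' t))"
  using locint[OF assms] by (auto intro: of_real_integrable)

sublocale sl_system M "ivl a b" s q
proof
  fix x y assume xy: "x \<in> ivl a b" "y \<in> ivl a b"
  show "{x..y} \<subseteq> ivl a b" by (rule ivl_interval[OF xy])
  show "set_integrable M {x..<y} s" "set_integrable M {x..<y} q"
    using coeff_integrable[OF xy] by (auto simp: of_real_diff intro: set_integral_diff)
next
  fix x assume "x \<in> ivl a b"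
  then show "measure M {x} *\<^sub>R (s x * q x) = 0" using atoms_sc[of x] by auto
qed

lemma primitive_L1loc_density:
  assumes F: "primitive (ivl a b) F \<phi>" and [measurable]: "d \<in> borel_measurable borel" and d0: "\<And>x. 0 \<le> d x"
    and d: "\<And>x y. x \<in> ivl a b \<Longrightarrow> y \<in> ivl a b \<Longrightarrow> set_integrable M {x..y} d"
  shows "L1loc a b (density M d) F"
proof -
  have "set_integrable (density M d) {x..y} F" if xy: "x \<in> ivl a b" "y \<in> ivl a b" for x y
  proof (rule set_integrable_densityI)
    have F': "primitive {x..y} F \<phi>" by (rule primitive_subset[OF F ivl_interval[OF xy]])
    show "(\<lambda>t. indicator {x..y} t *\<^sub>R F t) \<in> borel_measurable borel"
      by (rule primitive_measurable[OF F'])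
    have "integrable M (\<lambda>t. complex_of_real (indicator {x..y} t *\<^sub>R d t))"
      using d[OF xy] unfolding set_integrable_def by (rule integrable_of_real)
    then have "set_integrable M {x..y} (\<lambda>t. complex_of_real (d t))"
      unfolding set_integrable_def by (simp add: scaleR_conv_of_real)
    then show "set_integrable M {x..y} (\<lambda>t. F t * complex_of_real (d t))"
      by (rule primitive_mult_integrable[OF F']) auto
  qed (use d0 in auto)
  then show ?thesis by (subst L1loc_iff_Icc) auto
qed

lemma primitive_of_pint:
  assumes h: "L1loc a b (density M d) h" and [measurable]: "d \<in> borel_measurable borel" and d0: "\<And>x. 0 \<le> d x"
    and c: "c \<in> ivl a b"
  shows "primitive (ivl a b) (\<lambda>x. pint (density M d) c x h) (\<lambda>t. h t * complex_of_real (d t))"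
proof (rule primitiveI)
  fix x y assume xy: "x \<in> ivl a b" "y \<in> ivl a b" "x \<le> y"
  have i: "set_integrable (density M d) {x..<y} h"
    by (rule L1loc_Ico[OF h _ xy(1,2)]) simp
  note * = density_set_integrable[OF i _ d0]
  show "set_integrable M {x..<y} (\<lambda>t. h t * complex_of_real (d t))" by (rule *) simp
  show "pint (density M d) c y h = pint (density M d) c x h + (LINT t:{x..<y}|M. h t * complex_of_real (d t))"
    using pint_step[OF h _ c xy] *(2) by simp
qed

lemma primitive_of_sint:
  assumes h: "L1loc a b (density M d) h" "L1loc a b (density M d') h"
    and d: "d \<in> borel_measurable borel" "\<And>x. 0 \<le> d x"
    and d': "d' \<in> borel_measurable borel" "\<And>x. 0 \<le> d' x" and c: "c \<in> ivl a b"
  shows "primitive (ivl a b) (\<lambda>x. sint (density M d) (density M d') c x h) (\<lambda>t. h t * complex_of_real (d t - d' t))"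
  using primitive_diff[OF primitive_of_pint[OF h(1) d c] primitive_of_pint[OF h(2) d' c]]
  by (simp add: sint_def[abs_def] algebra_simps)

lemma sint_self[simp]: "sint \<mu> \<nu> c c h = 0"
  by (simp add: sint_def)

lemma primitive_shift:
  assumes "primitive D F \<phi>" "\<And>x. x \<in> D \<Longrightarrow> G x = k + F x"
  shows "primitive D G \<phi>"
proof (rule primitiveI)
  fix x y assume xy: "x \<in> D" "y \<in> D" "x \<le> y"
  show "set_integrable M {x..<y} \<phi>" by (rule primitiveD(1)[OF assms(1) xy])
  show "G y = G x + (LINT t:{x..<y}|M. \<phi> t)"
    unfolding assms(2)[OF xy(1)] assms(2)[OF xy(2)] primitiveD(2)[OF assms(1) xy] by simp
qed

lemma primitive_eqI:
  assumes "primitive D F \<phi>" "primitive D G \<phi>" "c \<in> D" "F c = G c" "x \<in> D"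
  shows "F x = G x"
proof -
  have "primitive D (\<lambda>x. F x - G x) (\<lambda>_. 0)"
    using primitive_diff[OF assms(1,2)] by simp
  from primitive_zero_imp_const[OF this assms(3,5)] show ?thesis using assms(4) by simp
qed

text \<open>\<open>F = - h0 + \<integral> f d\<chi>\<close> is known only almost everywhere for the
  variation of \<sigma>. The version \<open>h = \<integral> f d\<chi> - F\<close> is itself a
  primitive with values at every point; it differs from \<open>h0\<close> only where \<sigma> does
  not notice, so it generates \<open>f\<close> as well.\<close>

lemma tau_graph_imp_solves:
  assumes "tau_graph a b \<rho> sp sn cp cn f g"
  obtains h where "solves (ivl a b) (\<lambda>t. g t * r t) f h" "L1loc a b \<rho> g"
proof -
  obtain h0 F c where c: "c \<in> ivl a b" and f: "dens_real a b sp sn f h0" and F: "dens_pos a b \<rho> F g"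
    and AE1: "AE x in sp. x \<in> ivl a b \<longrightarrow> F x = - h0 x + sint cp cn c x f"
    and AE2: "AE x in sn. x \<in> ivl a b \<longrightarrow> F x = - h0 x + sint cp cn c x f"
    using assms unfolding tau_graph_def by blast
  obtain c1 where c1: "c1 \<in> ivl a b" "\<And>x. x \<in> ivl a b \<Longrightarrow> f x = f c1 + sint sp sn c1 x h0"
    and h0: "L1loc a b sp h0" "L1loc a b sn h0"
    using f unfolding dens_real_def by blast
  obtain c2 where c2: "c2 \<in> ivl a b" "\<And>x. x \<in> ivl a b \<Longrightarrow> F x = F c2 + pint \<rho> c2 x g"
    and g: "L1loc a b \<rho> g"
    using F unfolding dens_pos_def by blast
  have F: "primitive (ivl a b) F (\<lambda>t. g t * r t)"
    by (rule primitive_shift[OF primitive_of_pint[OF g _ _ c2(1)] c2(2)]) (auto simp: nonneg)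
  have f: "primitive (ivl a b) f (\<lambda>t. h0 t * s t)"
    by (rule primitive_shift[OF primitive_of_sint[OF h0 _ _ _ _ c1(1)] c1(2)]) (auto simp: nonneg)
  define h where "h x = sint cp cn c x f - F x" for x
  have "primitive (ivl a b) (\<lambda>x. sint cp cn c x f) (\<lambda>t. f t * q t)"
    by (rule primitive_of_sint[OF primitive_L1loc_density[OF f] primitive_L1loc_density[OF f] _ _ _ _ c])
      (auto simp: nonneg locint)
  then have h: "primitive (ivl a b) h (\<lambda>t. f t * q t - g t * r t)"
    using primitive_diff[OF _ F] unfolding h_def[abs_def] by blast
  have "AE x in M. x \<in> ivl a b \<longrightarrow> sp' x \<noteq> 0 \<longrightarrow> h0 x = h x"
    using AE1 nonneg(2) by (auto simp: AE_density h_def less_le algebra_simps elim!: eventually_mono)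
  moreover have "AE x in M. x \<in> ivl a b \<longrightarrow> sn' x \<noteq> 0 \<longrightarrow> h0 x = h x"
    using AE2 nonneg(3) by (auto simp: AE_density h_def less_le algebra_simps elim!: eventually_mono)
  \<comment> \<open>Almost everywhere, \<open>h0\<close> and \<open>h\<close> agree where
    \<open>sp'\<close> or \<open>sn'\<close> is nonzero; where both vanish, so does
    \<open>s\<close>.\<close>
  ultimately have ae: "AE x in M. x \<in> ivl a b \<longrightarrow> h0 x * s x = h x * s x"
    by eventually_elim auto
  have "primitive (ivl a b) f (\<lambda>t. h t * s t)"
  proof (rule primitiveI)
    fix x y assume xy: "x \<in> ivl a b" "y \<in> ivl a b" "x \<le> y"
    have sub: "{x..<y} \<subseteq> {x..y}" by auto
    show i: "set_integrable M {x..<y} (\<lambda>t. h t * s t)"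
      by (rule primitive_mult_integrable[OF primitive_subset[OF h I[OF xy(1,2)]] s_int[OF xy(1,2)] sub]) simp
    have "(LINT t:{x..<y}|M. h0 t * s t) = (LINT t:{x..<y}|M. h t * s t)"
      unfolding set_lebesgue_integral_def
    proof (rule integral_cong_AE)
      show "AE t in M. indicat_real {x..<y} t *\<^sub>R (h0 t * s t) = indicat_real {x..<y} t *\<^sub>R (h t * s t)"
        using ae
      proof eventually_elim
        case (elim t)
        then show ?case using subsetD[OF I[OF xy(1,2)], of t] by (cases "t \<in> {x..<y}") auto
      qed
      show "(\<lambda>t. indicat_real {x..<y} t *\<^sub>R (h t * s t)) \<in> borel_measurable M"
        using borel_measurable_integrable[OF i[unfolded set_integrable_def]] .
      show "(\<lambda>t. indicat_real {x..<y} t *\<^sub>R (h0 t * s t)) \<in> borel_measurable M"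
        using borel_measurable_integrable[OF primitiveD(1)[OF f xy, unfolded set_integrable_def]] .
    qed
    then show "f y = f x + (LINT t:{x..<y}|M. h t * s t)"
      using primitiveD(2)[OF f xy] by simp
  qed
  then have "solves (ivl a b) (\<lambda>t. g t * r t) f h" using h unfolding solves_def by blast
  then show thesis using g by (rule that)
qed

text \<open>With \<open>F = \<integral> f d\<chi> - h\<close> the identity required almost
  everywhere holds at every point of the interval.\<close>

lemma solves_imp_tau_graph:
  fixes g :: "real \<Rightarrow> complex"
  assumes f: "solves (ivl a b) (\<lambda>t. g t * r t) f h" and g: "L1loc a b \<rho> g"
  shows "tau_graph a b \<rho> sp sn cp cn f g"
proof -
  obtain c where c: "c \<in> ivl a b"
    using ereal_dense2[OF ab] by (auto simp: ivl_def)
  have fp: "primitive (ivl a b) f (\<lambda>t. h t * s t)" and hp: "primitive (ivl a b) h (\<lambda>t. f t * q t - g t * r t)"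
    using f unfolding solves_def by blast+
  have h1: "L1loc a b sp h" "L1loc a b sn h"
    by (rule primitive_L1loc_density[OF hp]; simp add: nonneg locint)+
  have f1: "L1loc a b cp f" "L1loc a b cn f"
    by (rule primitive_L1loc_density[OF fp]; simp add: nonneg locint)+
  define K where "K x = sint cp cn c x f" for x
  have K: "primitive (ivl a b) K (\<lambda>t. f t * q t)"
    unfolding K_def by (rule primitive_of_sint[OF f1 _ _ _ _ c]) (auto simp: nonneg)
  have S: "primitive (ivl a b) (\<lambda>x. sint sp sn c x h) (\<lambda>t. h t * s t)"
    by (rule primitive_of_sint[OF h1 _ _ _ _ c]) (auto simp: nonneg)
  have P: "primitive (ivl a b) (\<lambda>x. pint \<rho> c x g) (\<lambda>t. g t * r t)"
    by (rule primitive_of_pint[OF g _ _ c]) (auto simp: nonneg)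
  have d1: "dens_real a b sp sn f h"
    unfolding dens_real_def
  proof (intro conjI h1 bexI[OF _ c] ballI)
    fix x assume x: "x \<in> ivl a b"
    show "f x = f c + sint sp sn c x h"
      by (rule primitive_eqI[OF fp primitive_shift[OF S, where k = "f c"] c _ x]) simp_all
  qed
  have KF: "primitive (ivl a b) (\<lambda>x. K x - h x) (\<lambda>t. g t * r t)"
    using primitive_diff[OF K hp] by simp
  have d2: "dens_pos a b \<rho> (\<lambda>x. K x - h x) g"
    unfolding dens_pos_def
  proof (intro conjI g bexI[OF _ c] ballI)
    fix x assume x: "x \<in> ivl a b"
    show "K x - h x = K c - h c + pint \<rho> c x g"
      by (rule primitive_eqI[OF KF primitive_shift[OF P, where k = "K c - h c"] c _ x]) simp_all
  qed
  show ?thesis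
    unfolding tau_graph_def
    by (intro exI[of _ h] exI[of _ "\<lambda>x. K x - h x"] exI[of _ c] conjI c d1 d2) (auto simp: K_def)
qed

end

section \<open>Vanishing of the quasi-derivative\<close>

context line_measure
begin

text \<open>Half-lines are an intersection-stable generator of the Borel sets, and the sets over
  which \<open>G\<close> integrates to 0 form a Dynkin system. The whole line is not a half-line, so
  complements need \<open>tot\<close>.\<close>

lemma cum_zero_imp_AE_zero:
  fixes G :: "real \<Rightarrow> complex"
  assumes G: "integrable M G" and z: "\<And>x. cum G x = 0" and tot: "integral\<^sup>L M G = 0"
  shows "AE x in M. G x = 0"
proof (rule density_zero[OF G])
  fix A assume A: "A \<in> sets M"
  have si: "set_integrable M B G" if "B \<in> sets borel" for B
    unfolding set_integrable_def using G that by (intro integrable_mult_indicator) auto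
  have b: "sets (borel :: real measure) = sigma_sets UNIV (range lessThan)"
    unfolding borel_Iio by simp
  have st: "Int_stable (range (lessThan :: real \<Rightarrow> real set))"
    by (rule Int_stableI_image) (auto intro: exI[of _ "min _ _"])
  have cl: "range lessThan \<subseteq> Pow (UNIV :: real set)" by simp
  have "A \<in> sigma_sets UNIV (range lessThan)"
    using A b by simp
  from st cl this show "(LINT t:A|M. G t) = 0"
  proof (induction rule: sigma_sets_induct_disjoint)
    case (basic A)
    then show ?case using z by auto
  next
    case empty
    then show ?case by (simp add: set_lebesgue_integral_def)
  next
    case (compl A)
    then have A: "A \<in> sets borel" "UNIV - A \<in> sets borel" unfolding b by (auto intro: sigma_sets.Compl)
    have "(LINT t:A \<union> (UNIV - A)|M. G t) = (LINT t:A|M. G t) + (LINT t:UNIV - A|M. G t)"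
      by (rule set_integral_Un) (use si A in auto)
    moreover have "A \<union> (UNIV - A) = UNIV" by auto
    ultimately show ?case using compl tot by (simp add: set_lebesgue_integral_def)
  next
    case (union A)
    then have A: "A i \<in> sets M" for i using b by auto
    have "(LINT t:(\<Union>i. A i)|M. G t) = (\<Sum>i. (LINT t:(A i)|M. G t))"
      by (rule lebesgue_integral_countable_add[OF A])
        (use union(1) si A in \<open>auto simp: disjoint_family_on_def\<close>)
    then show ?case using union by simp
  qed
qed

text \<open>Approaching \<open>y\<close> strictly from below, the indicators of
  \<open>{..<t n}\<close> converge pointwise to that of \<open>{..<y}\<close>. From above an atom at
  \<open>y\<close> would survive in the limit.\<close>

lemma cum_left_continuous:
  fixes \<phi> :: "real \<Rightarrow> complex"
  assumes \<phi>: "integrable M \<phi>" and t: "\<And>n. t n < y" "t \<longlonglongrightarrow> y"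
  shows "(\<lambda>n. cum \<phi> (t n)) \<longlonglongrightarrow> cum \<phi> y"
  unfolding set_lebesgue_integral_def
proof (rule integral_dominated_convergence)
  have [measurable]: "\<phi> \<in> borel_measurable borel" using \<phi> by auto
  show "integrable M (\<lambda>x. norm (\<phi> x))" using \<phi> by simp
  show "AE x in M. (\<lambda>n. indicat_real {..<t n} x *\<^sub>R \<phi> x) \<longlonglongrightarrow> indicat_real {..<y} x *\<^sub>R \<phi> x"
  proof (rule AE_I2)
    fix x
    have "eventually (\<lambda>n. indicat_real {..<t n} x *\<^sub>R \<phi> x = indicat_real {..<y} x *\<^sub>R \<phi> x) sequentially"
    proof (cases "x < y")
      case True
      show ?thesis using order_tendstoD(1)[OF t(2) True] by eventually_elim (use True in auto)
    next
      case False
      then have "\<not> x < t n" for n using t(1)[of n] by simp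
      then show ?thesis using False by simp
    qed
    then show "(\<lambda>n. indicat_real {..<t n} x *\<^sub>R \<phi> x) \<longlonglongrightarrow> indicat_real {..<y} x *\<^sub>R \<phi> x"
      by (rule tendsto_eventually)
  qed
  show "AE x in M. norm (indicat_real {..<t n} x *\<^sub>R \<phi> x) \<le> norm (\<phi> x)" for n
    by (simp add: indicator_def)
  show "(\<lambda>x. indicat_real {..<y} x *\<^sub>R \<phi> x) \<in> borel_measurable M"
    "(\<lambda>x. indicat_real {..<t n} x *\<^sub>R \<phi> x) \<in> borel_measurable M" for n
    by simp_all
qed

end

context sl_measures
begin

text \<open>This is where full support of \<sigma> enters. Where \<open>f\<close> vanishes,
  \<open>h s\<close> is zero almost everywhere; no interval is free of \<sigma>, so zeros of
  \<open>h\<close> accumulate at \<open>y\<close> from the left, and left-continuity of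
  \<open>h\<close> concludes.\<close>

lemma quasi_derivative_zero:
  assumes sol: "solves (ivl a b) p f h" and J: "{e1<..<e2} \<subseteq> ivl a b" and y: "e1 < y" "y < e2"
    and f0: "\<And>t. e1 < t \<Longrightarrow> t < e2 \<Longrightarrow> f t = 0"
  shows "h y = 0"
proof -
  define x0 where "x0 = (e1 + y) / 2"
  have x0: "e1 < x0" "x0 < y" using y by (auto simp: x0_def)
  have I0: "{x0..y} \<subseteq> ivl a b" using J x0 y by auto
  have fp: "primitive {x0..y} f (\<lambda>t. h t * s t)" and hp: "primitive {x0..y} h (\<lambda>t. f t * q t - p t)"
    using solves_subset[OF sol I0] unfolding solves_def by blast+
  define G where "G t = indicator {x0..<y} t *\<^sub>R (h t * s t)" for t
  note P = primitive_cum_truncated[OF fp less_imp_le[OF x0(2)], folded G_def]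
  have cG: "cum G t = 0" if "t \<in> {x0..y}" for t
    using P(2)[OF that] f0[of t] f0[of x0] x0 y that by auto
  have G0: "AE t in M. G t = 0"
  proof (rule cum_zero_imp_AE_zero[OF P(1)])
    fix t
    consider "t \<in> {x0..y}" | "t < x0" | "y < t" by fastforce
    then show "cum G t = 0"
    proof cases
      case 2
      then show ?thesis unfolding set_lebesgue_integral_def
        by (intro integral_eq_zero_AE AE_I2) (auto simp: G_def indicator_def)
    next
      case 3
      have "cum G t = cum G y" unfolding set_lebesgue_integral_def
        by (rule Bochner_Integration.integral_cong) (use 3 in \<open>auto simp: G_def indicator_def\<close>)
      then show ?thesis using cG[of y] x0 by simp
    qed (rule cG)
    have "integral\<^sup>L M G = cum G y" unfolding set_lebesgue_integral_def
      by (rule Bochner_Integration.integral_cong) (auto simp: G_def indicator_def)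
    then show "integral\<^sup>L M G = 0" using cG[of y] x0 by simp
  qed
  \<comment> \<open>Without a zero of \<open>h\<close> between \<open>lo\<close> and
    \<open>y\<close>, the density \<open>s\<close> and by \<open>singular\<close> both
    \<open>sp'\<close> and \<open>sn'\<close> would vanish almost everywhere there, against
    \<open>full_support\<close>.\<close>
  have ex: "\<exists>t. lo < t \<and> t < y \<and> h t = 0" if lo: "x0 \<le> lo" "lo < y" for lo
  proof (rule ccontr)
    assume no: "\<not> ?thesis"
    let ?m = "(lo + y) / 2"
    have "?m \<in> ivl a b" "0 < (y - lo) / 2" using I0 lo by auto
    from full_support[OF this] have "\<not> (AE t in M. t \<in> ball ?m ((y - lo) / 2) \<longrightarrow> sp' t = 0 \<and> sn' t = 0)" .
    moreover have "AE t in M. t \<in> ball ?m ((y - lo) / 2) \<longrightarrow> sp' t = 0 \<and> sn' t = 0"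
      using G0 singular
    proof eventually_elim
      case (elim t)
      show ?case
      proof
        assume "t \<in> ball ?m ((y - lo) / 2)"
        then have t: "lo < t" "t < y" by (auto simp: dist_real_def abs_less_iff field_simps)
        then have "h t \<noteq> 0" using no by blast
        moreover have "h t * s t = 0" using elim(1) t lo by (simp add: G_def)
        ultimately show "sp' t = 0 \<and> sn' t = 0" using elim(2) by auto
      qed
    qed
    ultimately show False by blast
  qed
  \<comment> \<open>Left barriers that start at \<open>x0\<close> and tend to \<open>y\<close>; they
    force the chosen zeros \<open>t n\<close> to converge to \<open>y\<close>.\<close>
  define lo where "lo n = y - (y - x0) / real (Suc n)" for n
  have lo: "x0 \<le> lo n" "lo n < y" for n
    using x0 mult_right_mono[of x0 y "real n"] by (auto simp: lo_def field_simps)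
  have "\<forall>n. \<exists>t. lo n < t \<and> t < y \<and> h t = 0" using ex[OF lo] by blast
  then obtain t where t: "\<And>n. lo n < t n" "\<And>n. t n < y" "\<And>n. h (t n) = 0" by metis
  have "(\<lambda>n. (y - x0) / real (Suc n)) \<longlonglongrightarrow> 0"
    using tendsto_mult_right_zero[OF LIMSEQ_inverse_real_of_nat, of "y - x0"] by (simp add: divide_inverse)
  then have "lo \<longlonglongrightarrow> y - 0" unfolding lo_def[abs_def] by (intro tendsto_intros)
  then have lim: "t \<longlonglongrightarrow> y"
    by (intro tendsto_sandwich[of lo t sequentially "\<lambda>_. y"] always_eventually allI)
      (simp_all add: t less_imp_le)
  define \<phi> where "\<phi> t = indicator {x0..<y} t *\<^sub>R (f t * q t - p t)" for t
  note Q = primitive_cum_truncated[OF hp less_imp_le[OF x0(2)], folded \<phi>_def]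
  have "(\<lambda>n. h x0 + cum \<phi> (t n)) \<longlonglongrightarrow> h x0 + cum \<phi> y"
    by (intro tendsto_add tendsto_const cum_left_continuous[OF Q(1) t(2) lim])
  moreover have "h x0 + cum \<phi> (t n) = 0" for n
    using Q(2)[of "t n"] t[of n] lo(1)[of n] by simp
  moreover have "h x0 + cum \<phi> y = h y" using Q(2)[of y] x0 by simp
  ultimately show ?thesis by (simp add: LIMSEQ_const_iff)
qed

end

section \<open>Square integrable functions and linear functionals\<close>

lemma L2_mult:
  assumes "L2 N f" "L2 N g"
  shows "integrable N (\<lambda>x. f x * g x)"
proof (rule Bochner_Integration.integrable_bound)
  show "integrable N (\<lambda>x. (cmod (f x))\<^sup>2 + (cmod (g x))\<^sup>2)" using assms by (simp add: L2_def)
  show "(\<lambda>x. f x * g x) \<in> borel_measurable N"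
    using assms by (intro borel_measurable_times) (auto simp: L2_def)
  have "norm (f x * g x) \<le> norm ((cmod (f x))\<^sup>2 + (cmod (g x))\<^sup>2)" for x
  proof -
    have "0 \<le> cmod (f x) * cmod (g x)" by simp
    then have "cmod (f x) * cmod (g x) \<le> (cmod (f x))\<^sup>2 + (cmod (g x))\<^sup>2"
      using sum_squares_bound[of "cmod (f x)" "cmod (g x)"] by linarith
    then show ?thesis by (simp add: norm_mult)
  qed
  then show "AE x in N. norm (f x * g x) \<le> norm ((cmod (f x))\<^sup>2 + (cmod (g x))\<^sup>2)" by simp
qed

lemma L2_cnj: "L2 N f \<Longrightarrow> L2 N (\<lambda>x. cnj (f x))"
  unfolding L2_def by (auto intro: measurable_compose[OF _ borel_measurable_continuous_onI] continuous_intros)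

lemma L2_cmult: "L2 N f \<Longrightarrow> L2 N (\<lambda>x. c * f x)"
  unfolding L2_def by (auto simp: norm_mult power_mult_distrib)

lemma L2_bound:
  assumes "L2 N f" "g \<in> borel_measurable N" "\<And>x. cmod (g x) \<le> cmod (f x)"
  shows "L2 N g"
  using assms unfolding L2_def
  by (auto intro!: Bochner_Integration.integrable_bound[of N "\<lambda>x. (cmod (f x))\<^sup>2"] power_mono)

lemma L2_diff:
  assumes "L2 N f" "L2 N g"
  shows "L2 N (\<lambda>x. f x - g x)"
  unfolding L2_def
proof
  have [measurable]: "f \<in> borel_measurable N" "g \<in> borel_measurable N" using assms by (auto simp: L2_def)
  show "(\<lambda>x. f x - g x) \<in> borel_measurable N" by simp
  show "integrable N (\<lambda>x. (cmod (f x - g x))\<^sup>2)"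
  proof (rule Bochner_Integration.integrable_bound)
    show "integrable N (\<lambda>x. 2 * (cmod (f x))\<^sup>2 + 2 * (cmod (g x))\<^sup>2)" using assms by (simp add: L2_def)
    have "(cmod (f x - g x))\<^sup>2 \<le> 2 * (cmod (f x))\<^sup>2 + 2 * (cmod (g x))\<^sup>2" for x
    proof -
      have "(cmod (f x - g x))\<^sup>2 \<le> (cmod (f x) + cmod (g x))\<^sup>2"
        by (intro power_mono norm_triangle_ineq4) simp
      also have "\<dots> \<le> 2 * (cmod (f x))\<^sup>2 + 2 * (cmod (g x))\<^sup>2"
        using sum_squares_bound[of "cmod (f x)" "cmod (g x)"] by (simp add: power2_sum)
      finally show ?thesis .
    qed
    then show "AE x in N. norm ((cmod (f x - g x))\<^sup>2) \<le> norm (2 * (cmod (f x))\<^sup>2 + 2 * (cmod (g x))\<^sup>2)"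
      by simp
  qed simp
qed

lemma L2_indicator:
  assumes "L2 N f" "A \<in> sets N"
  shows "L2 N (\<lambda>x. indicator A x *\<^sub>R f x)"
  by (rule L2_bound[OF assms(1)]) (use assms in \<open>auto simp: L2_def indicator_def intro!: borel_measurable_scaleR borel_measurable_indicator\<close>)

text \<open>\<open>sub c v w\<close> stands for \<open>v - c w\<close>, so that a set of functions
  can serve as \<open>V\<close> without a vector space type. Subtracting the right multiple of one
  \<open>w\<close> with \<open>l1 w \<noteq> 0\<close> moves any \<open>v\<close> into the kernel of
  \<open>l1\<close>.\<close>

lemma functional_kernel:
  fixes l l1 :: "'v \<Rightarrow> complex" and sub :: "complex \<Rightarrow> 'v \<Rightarrow> 'v \<Rightarrow> 'v"
  assumes V: "\<And>c v w. v \<in> V \<Longrightarrow> w \<in> V \<Longrightarrow> sub c v w \<in> V"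
    and l: "\<And>c v w. v \<in> V \<Longrightarrow> w \<in> V \<Longrightarrow> l (sub c v w) = l v - c * l w"
    and l1: "\<And>c v w. v \<in> V \<Longrightarrow> w \<in> V \<Longrightarrow> l1 (sub c v w) = l1 v - c * l1 w"
    and ker: "\<And>v. v \<in> V \<Longrightarrow> l1 v = 0 \<Longrightarrow> l v = 0"
  obtains c where "\<And>v. v \<in> V \<Longrightarrow> l v = c * l1 v"
proof (cases "\<forall>v\<in>V. l1 v = 0")
  case True
  then show thesis using ker by (intro that[of 0]) auto
next
  case False
  then obtain w where w: "w \<in> V" "l1 w \<noteq> 0" by blast
  have "l v = l w / l1 w * l1 v" if v: "v \<in> V" for v
    using ker[OF V[OF v w(1)], of "l1 v / l1 w"] l[OF v w(1)] l1[OF v w(1)] w(2) by simp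
  then show thesis by (rule that)
qed

text \<open>The case of one functional is used twice: on the kernel of \<open>l2\<close> it gives
  \<open>c1\<close>; then \<open>l - c1 l1\<close> vanishes on that kernel and is a multiple of
  \<open>l2\<close>.\<close>

lemma functional_kernel_two:
  fixes l l1 l2 :: "'v \<Rightarrow> complex" and sub :: "complex \<Rightarrow> 'v \<Rightarrow> 'v \<Rightarrow> 'v"
  assumes V: "\<And>c v w. v \<in> V \<Longrightarrow> w \<in> V \<Longrightarrow> sub c v w \<in> V"
    and l: "\<And>c v w. v \<in> V \<Longrightarrow> w \<in> V \<Longrightarrow> l (sub c v w) = l v - c * l w"
    and l1: "\<And>c v w. v \<in> V \<Longrightarrow> w \<in> V \<Longrightarrow> l1 (sub c v w) = l1 v - c * l1 w"
    and l2: "\<And>c v w. v \<in> V \<Longrightarrow> w \<in> V \<Longrightarrow> l2 (sub c v w) = l2 v - c * l2 w"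
    and ker: "\<And>v. v \<in> V \<Longrightarrow> l1 v = 0 \<Longrightarrow> l2 v = 0 \<Longrightarrow> l v = 0"
  obtains c1 c2 where "\<And>v. v \<in> V \<Longrightarrow> l v = c1 * l1 v + c2 * l2 v"
proof -
  obtain c1 where c1: "\<And>v. v \<in> {v \<in> V. l2 v = 0} \<Longrightarrow> l v = c1 * l1 v"
    by (rule functional_kernel[of "{v \<in> V. l2 v = 0}" sub l l1]) (auto simp: V l l1 l2 ker)
  obtain c2 where c2: "\<And>v. v \<in> V \<Longrightarrow> l v - c1 * l1 v = c2 * l2 v"
    by (rule functional_kernel[of V sub "\<lambda>v. l v - c1 * l1 v" l2])
      (auto simp: V l l1 l2 c1 algebra_simps)
  show thesis
    using c2 by (intro that[of c1 c2]) (simp add: algebra_simps)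
qed

section \<open>The Lagrange identity and the adjoint\<close>

context sl_system
begin

lemma solves_cong:
  assumes "solves {x..y} p f h" "\<And>t. x \<le> t \<Longrightarrow> t < y \<Longrightarrow> p t = p' t"
  shows "solves {x..y} p' f h"
  using assms(1) unfolding solves_def
  by (elim conjE, intro conjI) (assumption, erule primitive_cong, simp_all add: assms(2))

end

context sl_measures
begin

text \<open>Holds because \<open>s\<close>, \<open>q\<close> and \<open>r\<close> are real. It
  mediates between the inner product, which conjugates one argument, and the bilinear Lagrange
  identity.\<close>

lemma solves_cnj:
  fixes g :: "real \<Rightarrow> complex"
  assumes "solves (ivl a b) (\<lambda>t. g t * r t) f h"
  shows "solves (ivl a b) (\<lambda>t. cnj (g t) * r t) (\<lambda>t. cnj (f t)) (\<lambda>t. cnj (h t))"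
  using primitive_cnj[of "ivl a b" f "\<lambda>t. h t * s t"]
    primitive_cnj[of "ivl a b" h "\<lambda>t. f t * q t - g t * r t"] assms
  unfolding solves_def by simp

lemma L1loc_cnj:
  assumes "L1loc a b \<rho> g"
  shows "L1loc a b \<rho> (\<lambda>t. cnj (g t))"
proof -
  have "(\<lambda>t. indicat_real K t *\<^sub>R cnj (g t)) = (\<lambda>t. cnj (indicat_real K t *\<^sub>R g t))" for K
    by simp
  then show ?thesis
    using assms unfolding L1loc_def set_integrable_def by (simp del: complex_cnj_scaleR)
qed

lemma admissible_density:
  fixes g :: "real \<Rightarrow> complex"
  assumes "L1loc a b \<rho> g"
  shows "admissible (\<lambda>t. g t * r t)"
  unfolding admissible_def
proof (intro conjI ballI)
  fix x y assume "x \<in> ivl a b" "y \<in> ivl a b"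
  then show "set_integrable M {x..<y} (\<lambda>t. g t * r t)"
    by (intro density_set_integrable(1) L1loc_Ico[OF assms]) (auto simp: nonneg)
next
  fix x assume "x \<in> ivl a b"
  then show "measure M {x} *\<^sub>R (s x * (g x * r x)) = 0" using atoms_sr[of x] by auto
qed

lemma primitive_mult_density:
  assumes u: "primitive (ivl a b) u \<phi>" and g: "L1loc a b \<rho> g" and xy: "x \<in> ivl a b" "y \<in> ivl a b"
  shows "set_integrable \<rho> {x..<y} (\<lambda>t. u t * g t)"
proof -
  have g': "set_integrable \<rho> {x..<y} g" by (rule L1loc_Ico[OF g _ xy]) simp
  have sub: "{x..<y} \<subseteq> {x..y}" by auto
  have u': "primitive {x..y} u \<phi>" by (rule primitive_subset[OF u ivl_interval[OF xy]])
  have i: "set_integrable M {x..<y} (\<lambda>t. g t * r t)"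
    by (rule density_set_integrable(1)[OF g']) (auto simp: nonneg)
  have "(\<lambda>t. (indicator {x..y} t *\<^sub>R u t) * (indicator {x..<y} t *\<^sub>R g t)) \<in> borel_measurable borel"
    using borel_measurable_integrable[OF g'[unfolded set_integrable_def]]
    by (intro borel_measurable_times primitive_measurable[OF u']) simp
  also have "(\<lambda>t. (indicator {x..y} t *\<^sub>R u t) * (indicator {x..<y} t *\<^sub>R g t)) = (\<lambda>t. indicator {x..<y} t *\<^sub>R (u t * g t))"
    by (intro ext) (auto split: split_indicator)
  finally show ?thesis
    using primitive_mult_integrable[OF u' i sub]
    by (intro set_integrable_densityI) (auto simp: nonneg mult.assoc)
qed

lemma lagrange_density:
  fixes f g h u v k :: "real \<Rightarrow> complex"
  assumes f: "solves (ivl a b) (\<lambda>t. g t * r t) f h" "L1loc a b \<rho> g"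
    and u: "solves (ivl a b) (\<lambda>t. v t * r t) u k" "L1loc a b \<rho> v"
    and xy: "x \<in> ivl a b" "y \<in> ivl a b" "x \<le> y"
  shows "set_integrable \<rho> {x..<y} (\<lambda>t. u t * g t - f t * v t)"
    and "f y * k y - u y * h y = f x * k x - u x * h x + (LINT t:{x..<y}|\<rho>. u t * g t - f t * v t)"
proof -
  have fp: "primitive (ivl a b) f (\<lambda>t. h t * s t)" using f(1) unfolding solves_def by blast
  have up: "primitive (ivl a b) u (\<lambda>t. k t * s t)" using u(1) unfolding solves_def by blast
  show i: "set_integrable \<rho> {x..<y} (\<lambda>t. u t * g t - f t * v t)"
    by (intro set_integral_diff primitive_mult_density[OF fp u(2) xy(1,2)] primitive_mult_density[OF up f(2) xy(1,2)])
  have "(LINT t:{x..<y}|\<rho>. u t * g t - f t * v t) = (LINT t:{x..<y}|M. (u t * g t - f t * v t) * r t)"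
    by (rule density_set_integrable(2)[OF i]) (auto simp: nonneg)
  also have "\<dots> = (LINT t:{x..<y}|M. u t * (g t * r t) - f t * (v t * r t))"
    by (simp add: algebra_simps)
  finally show "f y * k y - u y * h y = f x * k x - u x * h x + (LINT t:{x..<y}|\<rho>. u t * g t - f t * v t)"
    using primitiveD(2)[OF lagrange_identity[OF f(1) admissible_density[OF f(2)] u(1) admissible_density[OF u(2)] ivl_interval order_refl] xy]
    by simp
qed

lemma AE_density_ivl: "AE x in \<rho>. x \<in> ivl a b"
  using null_outside by (auto simp: AE_density elim: eventually_mono)

lemma ivl_below:
  assumes "x \<in> ivl a b"
  obtains e where "e < x" "e \<in> ivl a b"
proof -
  have "a < ereal x" using assms by (simp add: ivl_def)
  then obtain e where "a < ereal e" "ereal e < ereal x" using ereal_dense2 by blast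
  moreover from this have "ereal e < b" using assms less_trans unfolding ivl_def by blast
  ultimately show thesis using that[of e] by (simp add: ivl_def)
qed

lemma ivl_above:
  assumes "x \<in> ivl a b"
  obtains e where "x < e" "e \<in> ivl a b"
proof -
  have "ereal x < b" using assms by (simp add: ivl_def)
  then obtain e where "ereal x < ereal e" "ereal e < b" using ereal_dense2 by blast
  moreover from this have "a < ereal e" using assms less_trans unfolding ivl_def by blast
  ultimately show thesis using that[of e] by (simp add: ivl_def)
qed

text \<open>Serves to remove the boundary terms of a compactly supported solution. They contain
  \<open>h\<close> too, which is controlled through an open interval of zeros of
  \<open>f\<close>.\<close>

lemma quasi_derivative_zero_outside:
  assumes sol: "solves (ivl a b) p f h" and x0: "x0 \<in> ivl a b" "y0 \<in> ivl a b"
    and f0: "\<And>t. t \<in> ivl a b \<Longrightarrow> t \<notin> {x0..y0} \<Longrightarrow> f t = 0" and x: "x \<in> ivl a b" "x < x0 \<or> y0 < x"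
  shows "f x = 0" "h x = 0"
proof -
  show "f x = 0" using f0 x by auto
  show "h x = 0"
  proof (cases "x < x0")
    case True
    obtain e where e: "e < x" "e \<in> ivl a b" by (rule ivl_below[OF x(1)])
    have J: "{e<..<x0} \<subseteq> ivl a b" using ivl_interval[OF e(2) x0(1)] by auto
    show ?thesis
      by (rule quasi_derivative_zero[OF sol J e(1) True], rule f0) (use J in auto)
  next
    case False
    then have *: "y0 < x" using x by simp
    obtain e where e: "x < e" "e \<in> ivl a b" by (rule ivl_above[OF x(1)])
    have J: "{y0<..<e} \<subseteq> ivl a b" using ivl_interval[OF x0(2) e(2)] by auto
    show ?thesis
      by (rule quasi_derivative_zero[OF sol J * e(1)], rule f0) (use J in auto)
  qed
qed

text \<open>Both boundary terms vanish beyond the support of the element of \<open>T0\<close>, so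
  the Lagrange integrand has integral 0 over every large interval. Built from products of square
  integrable functions, it is integrable, and dominated convergence along an exhaustion gives the
  claim.\<close>

lemma Tmax_subset_adjoint:
  "Tmax a b \<rho> sp sn cp cn \<subseteq> adjoint_rel \<rho> (T0 a b \<rho> sp sn cp cn)"
proof (rule subrelI)
  fix f g assume "(f, g) \<in> Tmax a b \<rho> sp sn cp cn"
  then obtain f' g' where L2: "L2 \<rho> f" "L2 \<rho> g" and fg': "tau_graph a b \<rho> sp sn cp cn f' g'"
    and aef: "AE x in \<rho>. f x = f' x" "AE x in \<rho>. g x = g' x"
    unfolding Tmax_def by blast
  obtain h where h: "solves (ivl a b) (\<lambda>t. g' t * r t) f' h" "L1loc a b \<rho> g'"
    by (rule tau_graph_imp_solves[OF fg'])
  have "L2inner \<rho> f v = L2inner \<rho> g u" if uv: "(u, v) \<in> T0 a b \<rho> sp sn cp cn" for u v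
  proof -
    obtain u' v' K where L2': "L2 \<rho> u" "L2 \<rho> v" and uv': "tau_graph a b \<rho> sp sn cp cn u' v'"
      and K: "compact K" "K \<subseteq> ivl a b" "\<forall>x \<in> ivl a b - K. u' x = 0"
      and aeu: "AE x in \<rho>. u x = u' x" "AE x in \<rho>. v x = v' x"
      using uv unfolding T0_def by blast
    obtain k where k: "solves (ivl a b) (\<lambda>t. v' t * r t) u' k" "L1loc a b \<rho> v'"
      by (rule tau_graph_imp_solves[OF uv'])
    obtain l n :: "nat \<Rightarrow> real" where ln: "\<And>i. l i < n i" "\<And>i. l i \<in> ivl a b" "\<And>i. n i \<in> ivl a b"
      "\<And>t. t \<in> ivl a b \<Longrightarrow> eventually (\<lambda>i. l i < t \<and> t < n i) sequentially"
      by (rule ivl_exhaustion[OF ab], rule that)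
    have "ivl a b \<noteq> {}" using ln(2) by blast
    from compact_subset_ivl[OF K(1,2) this] obtain x0 y0
      where x0: "x0 \<in> ivl a b" "y0 \<in> ivl a b" "x0 \<le> y0" "K \<subseteq> {x0..y0}" .
    have z: "u' x = 0 \<and> k x = 0" if "x \<in> ivl a b" "x < x0 \<or> y0 < x" for x
      using quasi_derivative_zero_outside[OF k(1) x0(1,2) _ that] K(3) x0(4) by blast
    \<comment> \<open>Formed from the square integrable representatives, since the solutions
      themselves are unconstrained off the interval.\<close>
    define G where "G x = cnj (u x) * g x - f x * cnj (v x)" for x
    have i1: "integrable \<rho> (\<lambda>x. cnj (u x) * g x)" and i2: "integrable \<rho> (\<lambda>x. f x * cnj (v x))"
      by (rule L2_mult[OF L2_cnj[OF L2'(1)] L2(2)], rule L2_mult[OF L2(1) L2_cnj[OF L2'(2)]])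
    have G: "integrable \<rho> G"
      unfolding G_def using i1 i2 by (rule Bochner_Integration.integrable_diff)
    have Z: "(LINT t:{x..<y}|\<rho>. G t) = 0" if xy: "x \<in> ivl a b" "y \<in> ivl a b" "x < x0" "y0 < y" for x y
    proof -
      have le: "x \<le> y" using xy x0 by simp
      note L = lagrange_density[OF h solves_cnj[OF k(1)] L1loc_cnj[OF k(2)] xy(1,2) le]
      have "(LINT t:{x..<y}|\<rho>. G t) = (LINT t:{x..<y}|\<rho>. cnj (u' t) * g' t - f' t * cnj (v' t))"
        unfolding set_lebesgue_integral_def
      proof (rule integral_cong_AE)
        show "(\<lambda>t. indicat_real {x..<y} t *\<^sub>R G t) \<in> borel_measurable \<rho>"
          using borel_measurable_integrable[OF G] by simp
        show "(\<lambda>t. indicat_real {x..<y} t *\<^sub>R (cnj (u' t) * g' t - f' t * cnj (v' t))) \<in> borel_measurable \<rho>"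
          using borel_measurable_integrable[OF L(1)[unfolded set_integrable_def]] .
        show "AE t in \<rho>. indicat_real {x..<y} t *\<^sub>R G t = indicat_real {x..<y} t *\<^sub>R (cnj (u' t) * g' t - f' t * cnj (v' t))"
          using aef aeu by eventually_elim (simp add: G_def)
      qed
      also have "\<dots> = 0"
        using L(2) z[OF xy(1)] z[OF xy(2)] xy by simp
      finally show ?thesis .
    qed
    have "eventually (\<lambda>i. (LINT t:{l i..<n i}|\<rho>. G t) = 0) sequentially"
      using ln(4)[OF x0(1)] ln(4)[OF x0(2)] by eventually_elim (intro Z ln, simp_all)
    then have lim0: "(\<lambda>i. LINT t:{l i..<n i}|\<rho>. G t) \<longlonglongrightarrow> 0"
      by (rule tendsto_eventually)
    have "(\<lambda>i. LINT t:{l i..<n i}|\<rho>. G t) \<longlonglongrightarrow> integral\<^sup>L \<rho> G"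
      unfolding set_lebesgue_integral_def
    proof (rule integral_dominated_convergence)
      show mG: "G \<in> borel_measurable \<rho>" using G by (rule borel_measurable_integrable)
      show "(\<lambda>t. indicat_real {l i..<n i} t *\<^sub>R G t) \<in> borel_measurable \<rho>" for i using mG by simp
      show "integrable \<rho> (\<lambda>t. norm (G t))" using G by (rule integrable_norm)
      show "AE t in \<rho>. norm (indicat_real {l i..<n i} t *\<^sub>R G t) \<le> norm (G t)" for i
        by (simp add: indicator_def)
      show "AE t in \<rho>. (\<lambda>i. indicat_real {l i..<n i} t *\<^sub>R G t) \<longlonglongrightarrow> G t"
        using AE_density_ivl
      proof eventually_elim
        case (elim t)
        show ?case
          by (rule tendsto_eventually) (use ln(4)[OF elim] in \<open>auto elim!: eventually_mono\<close>)
      qed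
    qed
    then have "integral\<^sup>L \<rho> G = 0" using lim0 LIMSEQ_unique by blast
    then have "(LINT x|\<rho>. cnj (u x) * g x) = (LINT x|\<rho>. f x * cnj (v x))"
      unfolding G_def using i1 i2 by simp
    then show ?thesis unfolding L2inner_def by (simp add: mult.commute)
  qed
  then show "(f, g) \<in> adjoint_rel \<rho> (T0 a b \<rho> sp sn cp cn)"
    unfolding adjoint_rel_def using L2 by auto
qed

section \<open>Local square integrability and the dual pairing\<close>

lemma L2_bounded_support:
  assumes xy: "x \<in> ivl a b" "y \<in> ivl a b" and [measurable]: "w \<in> borel_measurable borel"
    and B: "\<And>t. cmod (w t) \<le> B" and w0: "\<And>t. t \<notin> {x..y} \<Longrightarrow> w t = 0"
  shows "L2 \<rho> w"
proof -
  have "integrable \<rho> (\<lambda>t. B\<^sup>2 * indicat_real {x..y} t)"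
    using locint(1)[OF xy] nonneg(1)
    by (intro integrable_mult_right) (simp add: integrable_density set_integrable_def mult.commute)
  then have "integrable \<rho> (\<lambda>t. (cmod (w t))\<^sup>2)"
  proof (rule Bochner_Integration.integrable_bound)
    show "AE t in \<rho>. norm ((cmod (w t))\<^sup>2) \<le> norm (B\<^sup>2 * indicat_real {x..y} t)"
      using B w0 by (auto simp: indicator_def intro!: power_mono)
  qed simp
  then show ?thesis by (simp add: L2_def)
qed

lemma L2_imp_L1loc:
  assumes "L2 \<rho> g"
  shows "L1loc a b \<rho> g"
proof -
  have "set_integrable \<rho> {x..y} g" if xy: "x \<in> ivl a b" "y \<in> ivl a b" for x y
  proof -
    have "L2 \<rho> (\<lambda>t. complex_of_real (indicator {x..y} t))"
      by (rule L2_bounded_support[OF xy, where B = 1]) (auto simp: indicator_def)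
    from L2_mult[OF this assms] show ?thesis
      by (simp add: set_integrable_def scaleR_conv_of_real)
  qed
  then show ?thesis by (subst L1loc_iff_Icc) auto
qed

text \<open>The class that contains all solutions: they are bounded on compact intervals but may
  fail to be square integrable near \<open>a\<close> and \<open>b\<close>.\<close>

definition locL2 :: "(real \<Rightarrow> complex) \<Rightarrow> bool" where
  "locL2 w \<longleftrightarrow> (\<forall>x\<in>ivl a b. \<forall>y\<in>ivl a b. L2 \<rho> (\<lambda>t. indicator {x..<y} t *\<^sub>R w t))"

lemma locL2_L2: "L2 \<rho> w \<Longrightarrow> locL2 w"
  unfolding locL2_def by (auto intro: L2_indicator)

lemma locL2_cmult: "locL2 w \<Longrightarrow> locL2 (\<lambda>t. c * w t)"
  unfolding locL2_def using L2_cmult[of \<rho> _ c] by (fastforce simp: mult_scaleR_right)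

lemma locL2_diff: "locL2 w \<Longrightarrow> locL2 w' \<Longrightarrow> locL2 (\<lambda>t. w t - w' t)"
  unfolding locL2_def scaleR_diff_right by (intro ballI L2_diff) blast+

lemma primitive_L2:
  assumes w: "primitive (ivl a b) w \<phi>" and xy: "x \<in> ivl a b" "y \<in> ivl a b"
  shows "L2 \<rho> (\<lambda>t. indicator {x..y} t *\<^sub>R w t)"
proof -
  have w': "primitive {x..y} w \<phi>" by (rule primitive_subset[OF w ivl_interval[OF xy]])
  obtain B where B: "\<And>t. norm (indicator {x..y} t *\<^sub>R w t) \<le> B" by (rule primitive_bounded[OF w'], rule that)
  show ?thesis
    by (rule L2_bounded_support[OF xy primitive_measurable[OF w'] B]) simp
qed

lemma locL2_primitive:
  assumes w: "primitive (ivl a b) w \<phi>"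
  shows "locL2 w"
  unfolding locL2_def
proof (intro ballI)
  fix x y assume xy: "x \<in> ivl a b" "y \<in> ivl a b"
  have "L2 \<rho> (\<lambda>t. indicator {x..<y} t *\<^sub>R (indicator {x..y} t *\<^sub>R w t))"
    by (rule L2_indicator[OF primitive_L2[OF w xy]]) simp
  also have "(\<lambda>t. indicator {x..<y} t *\<^sub>R (indicator {x..y} t *\<^sub>R w t)) = (\<lambda>t. indicator {x..<y} t *\<^sub>R w t)"
    by (intro ext) (auto split: split_indicator)
  finally show "L2 \<rho> (\<lambda>t. indicator {x..<y} t *\<^sub>R w t)" .
qed

text \<open>The test functions. Their half-open supports fit the intervals of the Lagrange identity,
  so that an atom at the right end \<open>y\<close> contributes nothing.\<close>

definition L2c :: "(real \<Rightarrow> complex) set" where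
  "L2c = {v. L2 \<rho> v \<and> (\<exists>x\<in>ivl a b. \<exists>y\<in>ivl a b. x \<le> y \<and> (\<forall>t. t \<notin> {x..<y} \<longrightarrow> v t = 0))}"

lemma L2cI: "L2 \<rho> v \<Longrightarrow> x \<in> ivl a b \<Longrightarrow> y \<in> ivl a b \<Longrightarrow> x \<le> y \<Longrightarrow>
    (\<And>t. t \<notin> {x..<y} \<Longrightarrow> v t = 0) \<Longrightarrow> v \<in> L2c"
  unfolding L2c_def by blast

lemma L2cE:
  assumes "v \<in> L2c"
  obtains x y where "L2 \<rho> v" "x \<in> ivl a b" "y \<in> ivl a b" "x \<le> y" "\<And>t. t \<notin> {x..<y} \<Longrightarrow> v t = 0"
  using assms unfolding L2c_def by blast

lemma L2c_sub:
  assumes "v \<in> L2c" "w \<in> L2c"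
  shows "(\<lambda>t. v t - c * w t) \<in> L2c"
proof -
  obtain x y where v: "L2 \<rho> v" "x \<in> ivl a b" "y \<in> ivl a b" "x \<le> y" "\<And>t. t \<notin> {x..<y} \<Longrightarrow> v t = 0"
    by (rule L2cE[OF assms(1)], rule that)
  obtain x' y' where w: "L2 \<rho> w" "x' \<in> ivl a b" "y' \<in> ivl a b" "x' \<le> y'" "\<And>t. t \<notin> {x'..<y'} \<Longrightarrow> w t = 0"
    by (rule L2cE[OF assms(2)], rule that)
  show ?thesis
  proof (rule L2cI)
    show "L2 \<rho> (\<lambda>t. v t - c * w t)" by (intro L2_diff L2_cmult v w)
    show "min x x' \<in> ivl a b" "max y y' \<in> ivl a b"
      using v w by (auto simp: min_def max_def)
    show "min x x' \<le> max y y'" using v(4) by auto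
    show "v t - c * w t = 0" if "t \<notin> {min x x'..<max y y'}" for t
      using v(5)[of t] w(5)[of t] that by (auto simp: min_le_iff_disj less_max_iff_disj)
  qed
qed

lemma locL2_L2c_integrable:
  assumes w: "locL2 w" and v: "v \<in> L2c"
  shows "integrable \<rho> (\<lambda>t. w t * v t)"
proof -
  obtain x y where v: "L2 \<rho> v" "x \<in> ivl a b" "y \<in> ivl a b" "\<And>t. t \<notin> {x..<y} \<Longrightarrow> v t = 0"
    by (rule L2cE[OF v], rule that)
  have "integrable \<rho> (\<lambda>t. (indicator {x..<y} t *\<^sub>R w t) * v t)"
    using w v(2,3) unfolding locL2_def by (intro L2_mult v(1)) blast
  also have "(\<lambda>t. (indicator {x..<y} t *\<^sub>R w t) * v t) = (\<lambda>t. w t * v t)"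
    using v(4) by (intro ext) (auto split: split_indicator)
  finally show ?thesis .
qed

text \<open>Bilinear, unlike \<open>L2inner\<close>: it is the integral that occurs in the Lagrange
  identity, and it is linear in the test function. The conjugation is put into the element of
  \<open>T0\<close> instead.\<close>

definition pair :: "(real \<Rightarrow> complex) \<Rightarrow> (real \<Rightarrow> complex) \<Rightarrow> complex" where
  "pair w v = (LINT t|\<rho>. w t * v t)"

lemma pair_sub:
  assumes "locL2 w" "v \<in> L2c" "v' \<in> L2c"
  shows "pair w (\<lambda>t. v t - c * v' t) = pair w v - c * pair w v'"
proof -
  note i = locL2_L2c_integrable[OF assms(1,2)] locL2_L2c_integrable[OF assms(1,3)]
  have "pair w (\<lambda>t. v t - c * v' t) = (LINT t|\<rho>. w t * v t - c * (w t * v' t))"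
    unfolding pair_def by (simp add: algebra_simps)
  also have "\<dots> = pair w v - c * pair w v'"
    unfolding pair_def using i by simp
  finally show ?thesis .
qed

lemma pair_diff_left:
  assumes "locL2 w" "locL2 w'" "v \<in> L2c"
  shows "pair (\<lambda>t. w t - w' t) v = pair w v - pair w' v"
  unfolding pair_def left_diff_distrib
  by (rule Bochner_Integration.integral_diff; rule locL2_L2c_integrable[OF _ assms(3)]; fact)

lemma pair_cmult_left: "pair (\<lambda>t. c * w t) v = c * pair w v"
  unfolding pair_def mult.assoc by simp

lemma pair_eq_0_imp_AE:
  assumes w: "locL2 w" and z: "\<And>v. v \<in> L2c \<Longrightarrow> pair w v = 0"
  shows "AE t in \<rho>. w t = 0"
proof -
  have ae: "AE t in \<rho>. t \<in> {x..<y} \<longrightarrow> w t = 0" if xy: "x \<in> ivl a b" "y \<in> ivl a b" "x \<le> y" for x y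
  proof -
    \<comment> \<open>Testing with the conjugate of the truncated \<open>w\<close> turns the pairing
      into the square of a local norm.\<close>
    define v where "v t = cnj (indicator {x..<y} t *\<^sub>R w t)" for t
    have vL: "L2 \<rho> v"
      unfolding v_def by (rule L2_cnj) (use w xy in \<open>auto simp: locL2_def\<close>)
    have v: "v \<in> L2c"
      by (rule L2cI[OF vL xy]) (simp add: v_def)
    have e: "w t * v t = complex_of_real ((cmod (v t))\<^sup>2)" for t
      unfolding complex_norm_square v_def by (auto split: split_indicator)
    have i: "integrable \<rho> (\<lambda>t. (cmod (v t))\<^sup>2)" using vL by (simp add: L2_def)
    have "complex_of_real (LINT t|\<rho>. (cmod (v t))\<^sup>2) = 0"
      using z[OF v] unfolding pair_def e integral_complex_of_real .
    then have "(LINT t|\<rho>. (cmod (v t))\<^sup>2) = 0" by simp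
    then have "AE t in \<rho>. (cmod (v t))\<^sup>2 = 0"
      using integral_nonneg_eq_0_iff_AE[OF i] by simp
    then show ?thesis by eventually_elim (auto simp: v_def)
  qed
  obtain l n :: "nat \<Rightarrow> real" where ln: "\<And>i. l i < n i" "\<And>i. l i \<in> ivl a b" "\<And>i. n i \<in> ivl a b"
    "\<And>t. t \<in> ivl a b \<Longrightarrow> eventually (\<lambda>i. l i < t \<and> t < n i) sequentially"
    by (rule ivl_exhaustion[OF ab], rule that)
  have "AE t in \<rho>. \<forall>i. t \<in> {l i..<n i} \<longrightarrow> w t = 0"
    unfolding AE_all_countable using ae[OF ln(2,3) less_imp_le[OF ln(1)]] by blast
  then show ?thesis using AE_density_ivl
  proof eventually_elim
    case (elim t)
    then obtain i where "l i < t \<and> t < n i"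
      using eventually_happens'[OF sequentially_bot ln(4)] by blast
    then show ?case using elim(1) by auto
  qed
qed

text \<open>If \<open>v\<close> is orthogonal to the homogeneous solutions, then the solution of the equation with
  right-hand side \<open>v\<close> starting from zero data to the left of the support of \<open>v\<close> vanishes again
  to the right of it, by the Lagrange identity, and so yields an element of \<open>T0\<close>.\<close>
lemma orthogonal_solution_compact:
  assumes u1: "solves (ivl a b) (\<lambda>_. 0) u1 v1" and u2: "solves (ivl a b) (\<lambda>_. 0) u2 v2"
    and W: "\<And>t. t \<in> ivl a b \<Longrightarrow> u1 t * v2 t - u2 t * v1 t = 1"
    and v: "L2 \<rho> v" and xy: "x \<in> ivl a b" "y \<in> ivl a b" "x \<le> y"
    and v0: "\<And>t. t \<notin> {x..<y} \<Longrightarrow> v t = 0"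
    and orth: "pair u1 v = 0" "pair u2 v = 0"
  obtains u k where "solves (ivl a b) (\<lambda>t. v t * r t) u k" "u x = 0" "k x = 0" "u y = 0" "k y = 0"
    "\<And>t. t \<in> ivl a b \<Longrightarrow> t \<notin> {x..<y} \<Longrightarrow> u t = 0"
proof -
  have vl: "L1loc a b \<rho> v" by (rule L2_imp_L1loc[OF v])
  obtain u k where u: "solves (ivl a b) (\<lambda>t. v t * r t) u k" and ux: "u x = 0" "k x = 0"
    by (rule ivp[OF xy(1) admissible_density[OF vl]], rule that)
  have L0: "L1loc a b \<rho> (\<lambda>_. 0)" by (simp add: L1loc_def set_integrable_def)
  \<comment> \<open>The boundary terms at \<open>x\<close> vanish by the zero data and the integral
    by orthogonality, which leaves a zero Wronskian at \<open>y\<close>. Two independent choices of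
    \<open>z\<close> then force zero data at \<open>y\<close>.\<close>
  have *: "u y * w y = z y * k y" if z: "solves (ivl a b) (\<lambda>_. 0) z w" and o: "pair z v = 0" for z w
  proof -
    have z': "solves (ivl a b) (\<lambda>t. (0::complex) * r t) z w" using z by simp
    have "(LINT t:{x..<y}|\<rho>. z t * v t - u t * 0) = pair z v"
      unfolding pair_def set_lebesgue_integral_def
      by (rule Bochner_Integration.integral_cong) (use v0 in \<open>auto split: split_indicator\<close>)
    then show ?thesis
      using lagrange_density(2)[OF u vl z' L0 xy] o ux by simp
  qed
  have "u y * v1 y = u1 y * k y" "u y * v2 y = u2 y * k y"
    using *[OF u1 orth(1)] *[OF u2 orth(2)] by auto
  with W[OF xy(2)] have uy: "u y = 0" "k y = 0" by algebra+
  \<comment> \<open>Off \<open>{x..<y}\<close> the right-hand side is zero, so \<open>u\<close> is a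
    homogeneous solution with zero data at \<open>x\<close> or at \<open>y\<close>.\<close>
  have "u t = 0" if t: "t \<in> ivl a b" "t \<notin> {x..<y}" for t
  proof (cases "t < x")
    case True
    have "solves {t..x} (\<lambda>t. v t * r t) u k" by (rule solves_subset[OF u ivl_interval[OF t(1) xy(1)]])
    then have "solves {t..x} (\<lambda>_. 0) u k" by (rule solves_cong) (simp add: v0)
    from homogeneous_unique(1)[OF t(1) xy(1) this _ ux, of t] show ?thesis using True by simp
  next
    case False
    then have yt: "y \<le> t" using t by auto
    have "solves {y..t} (\<lambda>t. v t * r t) u k" by (rule solves_subset[OF u ivl_interval[OF xy(2) t(1)]])
    then have "solves {y..t} (\<lambda>_. 0) u k" by (rule solves_cong) (simp add: v0)
    from homogeneous_unique(1)[OF xy(2) t(1) this _ uy, of t] show ?thesis using yt by simp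
  qed
  with u ux uy show thesis by (intro that)
qed

lemma adjoint_subset_Tmax:
  "adjoint_rel \<rho> (T0 a b \<rho> sp sn cp cn) \<subseteq> Tmax a b \<rho> sp sn cp cn"
proof (rule subrelI)
  fix f g assume "(f, g) \<in> adjoint_rel \<rho> (T0 a b \<rho> sp sn cp cn)"
  then have f: "L2 \<rho> f" and g: "L2 \<rho> g"
    and adj: "\<And>u v. (u, v) \<in> T0 a b \<rho> sp sn cp cn \<Longrightarrow> L2inner \<rho> f v = L2inner \<rho> g u"
    unfolding adjoint_rel_def by auto
  have gl: "L1loc a b \<rho> g" by (rule L2_imp_L1loc[OF g])
  obtain c where c: "c \<in> ivl a b" using ereal_dense2[OF ab] by (auto simp: ivl_def)
  obtain ft ht where ft: "solves (ivl a b) (\<lambda>t. g t * r t) ft ht" and "ft c = 0" "ht c = 0"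
    by (rule ivp[OF c admissible_density[OF gl]], rule that)
  obtain u1 v1 where u1: "solves (ivl a b) (\<lambda>_. 0) u1 v1" "u1 c = 1" "v1 c = 0"
    by (rule ivp[OF c admissible_0], rule that)
  obtain u2 v2 where u2: "solves (ivl a b) (\<lambda>_. 0) u2 v2" "u2 c = 0" "v2 c = 1"
    by (rule ivp[OF c admissible_0], rule that)
  have "primitive (ivl a b) (\<lambda>t. u1 t * v2 t - u2 t * v1 t) (\<lambda>_. 0)"
    using lagrange_identity[OF u1(1) admissible_0 u2(1) admissible_0 ivl_interval order_refl] by simp
  from primitive_zero_imp_const[OF this _ c]
  have W: "u1 t * v2 t - u2 t * v1 t = 1" if "t \<in> ivl a b" for t
    using that u1 u2 by simp
  have prim: "locL2 u" if "solves (ivl a b) p u k" for p u k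
    using that unfolding solves_def by (blast intro: locL2_primitive)
  define w where "w t = f t - ft t" for t
  have lw: "locL2 w" unfolding w_def by (intro locL2_diff locL2_L2 f prim[OF ft])
  note l1 = prim[OF u1(1)] and l2 = prim[OF u2(1)]
  have ker: "pair w v = 0" if v: "v \<in> L2c" and o: "pair u1 v = 0" "pair u2 v = 0" for v
  proof -
    obtain x y where vL: "L2 \<rho> v" and xy: "x \<in> ivl a b" "y \<in> ivl a b" "x \<le> y"
      and v0: "\<And>t. t \<notin> {x..<y} \<Longrightarrow> v t = 0"
      by (rule L2cE[OF v], rule that)
    obtain u k where u: "solves (ivl a b) (\<lambda>t. v t * r t) u k"
      and ux: "u x = 0" "k x = 0" "u y = 0" "k y = 0"
      and u0: "\<And>t. t \<in> ivl a b \<Longrightarrow> t \<notin> {x..<y} \<Longrightarrow> u t = 0"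
      by (rule orthogonal_solution_compact[OF u1(1) u2(1) W vL xy v0 o], assumption, assumption, rule that)
    have vl: "L1loc a b \<rho> v" by (rule L2_imp_L1loc[OF vL])
    \<comment> \<open>Values of \<open>u\<close> off the interval are arbitrary; the cut-off
      supplies a representative that is measurable and square integrable on the whole line.\<close>
    define U where "U t = indicator {x..y} t *\<^sub>R u t" for t
    have U: "U t = u t" if "t \<in> ivl a b" for t
      using u0[OF that] by (auto simp: U_def split: split_indicator)
    have "primitive (ivl a b) u (\<lambda>t. k t * s t)" using u unfolding solves_def by blast
    from primitive_L2[OF this xy(1,2)] have UL: "L2 \<rho> U" unfolding U_def .
    \<comment> \<open>The conjugates undo the one in \<open>L2inner\<close>, so that the adjoint
      relation becomes an identity for \<open>pair\<close>.\<close>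
    have "((\<lambda>t. cnj (U t)), (\<lambda>t. cnj (v t))) \<in> T0 a b \<rho> sp sn cp cn"
      unfolding T0_def mem_Collect_eq prod.case
    proof (intro conjI exI)
      show "L2 \<rho> (\<lambda>t. cnj (U t))" "L2 \<rho> (\<lambda>t. cnj (v t))" by (intro L2_cnj UL vL)+
      show "tau_graph a b \<rho> sp sn cp cn (\<lambda>t. cnj (u t)) (\<lambda>t. cnj (v t))"
        by (rule solves_imp_tau_graph[OF solves_cnj[OF u] L1loc_cnj[OF vl]])
      show "compact {x..y}" "{x..y} \<subseteq> ivl a b" using ivl_interval[OF xy(1,2)] by auto
      show "\<forall>t\<in>ivl a b - {x..y}. cnj (u t) = 0" using u0 by auto
      show "AE t in \<rho>. cnj (U t) = cnj (u t)"
        using AE_density_ivl by eventually_elim (simp add: U)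
      show "AE t in \<rho>. cnj (v t) = cnj (v t)" by simp
    qed
    from adj[OF this] have fg: "pair f v = pair g U"
      by (simp add: L2inner_def pair_def mult.commute)
    have "0 = (LINT t:{x..<y}|\<rho>. u t * g t - ft t * v t)"
      using lagrange_density(2)[OF ft gl u vl xy] ux by simp
    \<comment> \<open>\<open>U\<close> is cut off to a closed interval and the integral to a
      half-open one; they differ only at \<open>y\<close>, where \<open>u\<close> is zero.\<close>
    also have "\<dots> = (LINT t|\<rho>. g t * U t - ft t * v t)"
      unfolding set_lebesgue_integral_def
      by (rule Bochner_Integration.integral_cong)
        (use v0 ux in \<open>auto simp: U_def indicator_def mult.commute less_le\<close>)
    also have "\<dots> = pair g U - pair ft v"
      unfolding pair_def
      by (rule Bochner_Integration.integral_diff[OF L2_mult[OF g UL] locL2_L2c_integrable[OF prim[OF ft] v]])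
    finally have "pair g U = pair ft v" by simp
    with fg show ?thesis
      unfolding w_def using pair_diff_left[OF locL2_L2[OF f] prim[OF ft] v] by simp
  qed
  \<comment> \<open>By \<open>ker\<close>, the functional \<open>pair w\<close> vanishes on the
    common kernel of \<open>pair u1\<close> and \<open>pair u2\<close>, so it is a combination of
    these two.\<close>
  obtain c1 c2 where cc: "\<And>v. v \<in> L2c \<Longrightarrow> pair w v = c1 * pair u1 v + c2 * pair u2 v"
    by (rule functional_kernel_two[of L2c "\<lambda>c v w t. v t - c * w t" "pair w" "pair u1" "pair u2"])
      (use ker in \<open>auto intro: L2c_sub pair_sub lw l1 l2\<close>)
  define z where "z t = w t - c1 * u1 t - c2 * u2 t" for t
  have lz: "locL2 z" unfolding z_def by (intro locL2_diff locL2_cmult lw l1 l2)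
  have "pair z v = 0" if v: "v \<in> L2c" for v
  proof -
    have "pair z v = pair w v - c1 * pair u1 v - c2 * pair u2 v"
      unfolding z_def
      using pair_diff_left[OF locL2_diff[OF lw locL2_cmult[OF l1, of c1]] locL2_cmult[OF l2, of c2] v]
        pair_diff_left[OF lw locL2_cmult[OF l1, of c1] v] pair_cmult_left
      by simp
    then show ?thesis using cc[OF v] by simp
  qed
  from pair_eq_0_imp_AE[OF lz this] have "AE t in \<rho>. z t = 0" .
  then have ae: "AE t in \<rho>. f t = ft t + (c1 * u1 t + c2 * u2 t)"
    by eventually_elim (simp add: z_def w_def algebra_simps)
  have "solves (ivl a b) (\<lambda>t. g t * r t) (\<lambda>t. ft t + (c1 * u1 t + c2 * u2 t))
      (\<lambda>t. ht t + (c1 * v1 t + c2 * v2 t))"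
    using solves_add[OF ft solves_add[OF solves_cmult[OF u1(1), of c1] solves_cmult[OF u2(1), of c2]]] by simp
  from solves_imp_tau_graph[OF this gl] show "(f, g) \<in> Tmax a b \<rho> sp sn cp cn"
    unfolding Tmax_def mem_Collect_eq prod.case using f g ae by blast
qed

theorem adjoint_T0_eq_Tmax: "adjoint_rel \<rho> (T0 a b \<rho> sp sn cp cn) = Tmax a b \<rho> sp sn cp cn"
  using adjoint_subset_Tmax Tmax_subset_adjoint by (rule subset_antisym)

end

section \<open>Passage from the given measures to their densities\<close>

lemma measure_density_singleton:
  fixes d :: "real \<Rightarrow> real"
  assumes [measurable_cong, simp]: "sets M = sets borel" and [measurable]: "d \<in> borel_measurable borel" and d0: "0 \<le> d x"
  shows "measure (density M d) {x} = d x * measure M {x}"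
proof -
  have "emeasure (density M d) {x} = (\<integral>\<^sup>+t. ennreal (d t) * indicator {x} t \<partial>M)"
    by (rule emeasure_density) simp_all
  also have "\<dots> = (\<integral>\<^sup>+t. ennreal (d x) * indicator {x} t \<partial>M)"
    by (rule nn_integral_cong) (auto simp: indicator_def)
  also have "\<dots> = ennreal (d x) * emeasure M {x}"
    by (rule nn_integral_cmult_indicator) simp
  finally show ?thesis
    using d0 by (simp add: measure_def enn2real_mult)
qed

lemma density_locint:
  fixes d :: "real \<Rightarrow> real"
  assumes [measurable_cong, simp]: "sets M = sets borel" and [measurable]: "d \<in> borel_measurable borel" and d0: "\<And>x. 0 \<le> d x"
    and l: "locfin_pos a b (density M d)" and xy: "x \<in> ivl a b" "y \<in> ivl a b"
  shows "set_integrable M {x..y} d"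
  unfolding set_integrable_def
proof (rule integrableI_bounded)
  have "(\<integral>\<^sup>+t. ennreal (norm (indicator {x..y} t *\<^sub>R d t)) \<partial>M) = (\<integral>\<^sup>+t. ennreal (d t) * indicator {x..y} t \<partial>M)"
    using d0 by (intro nn_integral_cong) (auto simp: indicator_def)
  also have "\<dots> = emeasure (density M d) {x..y}"
    by (rule emeasure_density[symmetric]) simp_all
  also have "\<dots> < \<infinity>"
    using l ivl_interval[OF xy] unfolding locfin_pos_def by (simp add: compact_Icc)
  finally show "(\<integral>\<^sup>+t. ennreal (norm (indicator {x..y} t *\<^sub>R d t)) \<partial>M) < \<infinity>" .
qed simp

lemma emeasure_density_eq_0:
  fixes d :: "real \<Rightarrow> real"
  assumes [measurable_cong, simp]: "sets M = sets borel" and [measurable]: "d \<in> borel_measurable borel" and d0: "\<And>x. 0 \<le> d x"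
    and [measurable]: "A \<in> sets borel"
  shows "emeasure (density M d) A = 0 \<longleftrightarrow> (AE x in M. x \<in> A \<longrightarrow> d x = 0)"
proof -
  have "emeasure (density M d) A = 0 \<longleftrightarrow> (AE x in M. ennreal (d x) * indicator A x = 0)"
    by (subst emeasure_density) (simp_all add: nn_integral_0_iff_AE)
  also have "\<dots> \<longleftrightarrow> (AE x in M. x \<in> A \<longrightarrow> d x = 0)"
    using d0 by (intro arg_cong[of _ _ "\<lambda>P. AE x in M. P x"] ext) (auto simp: indicator_def ennreal_eq_0_iff antisym)
  finally show ?thesis .
qed

theorem theorem4p4:
  fixes a b :: ereal and \<rho> sp sn cp cn :: "real measure"
  assumes ab: "a < b"
    and H1: "locfin_pos a b \<rho>"
    and H2: "locfin_real a b cp cn"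
    and H3: "locfin_real a b sp sn" "rsupp a b sp sn = ivl a b"
    and H4: "\<forall>x \<in> ivl a b. rmass sp sn x * rmass cp cn x = 0 \<and> rmass sp sn x * measure \<rho> {x} = 0"
    and H5: "\<forall>\<alpha> \<beta> f. \<alpha> < \<beta> \<and> \<alpha> \<in> msupp a b \<rho> \<and> \<beta> \<in> msupp a b \<rho> \<and>
               {\<alpha><..<\<beta>} \<inter> msupp a b \<rho> = {} \<and> in_Dtau a b \<rho> sp sn cp cn f \<and>
               (f \<longlongrightarrow> 0) (at_left \<alpha>) \<and> (f \<longlongrightarrow> 0) (at_right \<beta>)
               \<longrightarrow> (\<forall>x \<in> {\<alpha><..<\<beta>}. f x = 0)"
    and H6: "\<exists>x y. x \<noteq> y \<and> x \<in> msupp a b \<rho> \<and> y \<in> msupp a b \<rho>"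
  shows "adjoint_rel \<rho> (T0 a b \<rho> sp sn cp cn) = Tmax a b \<rho> sp sn cp cn"
proof -
  have lf: "locfin_pos a b \<rho>" "locfin_pos a b sp" "locfin_pos a b sn" "locfin_pos a b cp" "locfin_pos a b cn"
    using H1 H2 H3 by (auto simp: locfin_real_def)
  \<comment> \<open>All five measures are summands, hence absolutely continuous with respect to
    \<open>M\<close>, and \<open>M\<close> is again locally finite.\<close>
  define M where "M = msum \<rho> (msum sp (msum sn (msum cp cn)))"
  have lM: "locfin_pos a b M" unfolding M_def by (intro locfin_pos_msum lf)
  have sM[simp]: "sets M = sets borel" by (simp add: M_def)
  have st: "sets \<rho> = sets borel" "sets sp = sets borel" "sets sn = sets borel" "sets cp = sets borel" "sets cn = sets borel"
    using lf by (auto simp: locfin_pos_def)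
  have eM: "emeasure M A = emeasure \<rho> A + (emeasure sp A + (emeasure sn A + (emeasure cp A + emeasure cn A)))"
    if "A \<in> sets borel" for A
    using that by (simp add: M_def emeasure_msum st)
  obtain r :: "real \<Rightarrow> real" where r: "r \<in> borel_measurable borel" "\<And>x. 0 \<le> r x" "\<rho> = density M r"
    by (rule locfin_pos_density[OF lM lf(1) ab _ that]) (simp_all add: eM)
  obtain p :: "real \<Rightarrow> real" where p: "p \<in> borel_measurable borel" "\<And>x. 0 \<le> p x" "sp = density M p"
    by (rule locfin_pos_density[OF lM lf(2) ab _ that]) (simp_all add: eM)
  obtain n :: "real \<Rightarrow> real" where n: "n \<in> borel_measurable borel" "\<And>x. 0 \<le> n x" "sn = density M n"
    by (rule locfin_pos_density[OF lM lf(3) ab _ that]) (simp_all add: eM)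
  obtain p' :: "real \<Rightarrow> real" where p': "p' \<in> borel_measurable borel" "\<And>x. 0 \<le> p' x" "cp = density M p'"
    by (rule locfin_pos_density[OF lM lf(4) ab _ that]) (simp_all add: eM)
  obtain n' :: "real \<Rightarrow> real" where n': "n' \<in> borel_measurable borel" "\<And>x. 0 \<le> n' x" "cn = density M n'"
    by (rule locfin_pos_density[OF lM lf(5) ab _ that]) (simp_all add: eM)
  note mass = measure_density_singleton[OF sM r(1) r(2), folded r(3)]
    measure_density_singleton[OF sM p(1) p(2), folded p(3)] measure_density_singleton[OF sM n(1) n(2), folded n(3)]
    measure_density_singleton[OF sM p'(1) p'(2), folded p'(3)] measure_density_singleton[OF sM n'(1) n'(2), folded n'(3)]
  interpret sl_measures M a b r p n p' n'
  proof (intro sl_measures.intro line_measure.intro line_measure_axioms.intro sl_measures_axioms.intro)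
    show "sigma_finite_measure M" by (rule locfin_pos_sigma_finite[OF lM ab])
    show "AE x in M. x \<in> ivl a b"
      using lM by (intro AE_I[of _ _ "- ivl a b"]) (auto simp: locfin_pos_def)
    obtain A where A: "A \<in> sets borel" "emeasure sp (- A) = 0" "emeasure sn A = 0"
      using H3(1) by (auto simp: locfin_real_def)
    have "AE x in M. x \<in> - A \<longrightarrow> p x = 0" "AE x in M. x \<in> A \<longrightarrow> n x = 0"
      using A emeasure_density_eq_0[OF sM p(1,2), of "- A"] emeasure_density_eq_0[OF sM n(1,2), of A]
      by (auto simp flip: p(3) n(3))
    then show "AE x in M. p x = 0 \<or> n x = 0" by eventually_elim auto
    show "measure M {x} * ((p x - n x) * (p' x - n' x)) = 0" "measure M {x} * ((p x - n x) * r x) = 0"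
      if "x \<in> ivl a b" for x
    proof -
      have "rmass sp sn x * rmass cp cn x = 0" "rmass sp sn x * measure \<rho> {x} = 0"
        using H4 that by auto
      \<comment> \<open>Written with densities, the products of masses carry the square of
        \<open>measure M {x}\<close>, which vanishes exactly when the first power does.\<close>
      then show "measure M {x} * ((p x - n x) * (p' x - n' x)) = 0" "measure M {x} * ((p x - n x) * r x) = 0"
        unfolding rmass_def mass by (auto simp flip: left_diff_distrib)
    qed
    show "\<not> (AE t in M. t \<in> ball x e \<longrightarrow> p t = 0 \<and> n t = 0)" if x: "x \<in> ivl a b" "0 < e" for x e
    proof
      assume "AE t in M. t \<in> ball x e \<longrightarrow> p t = 0 \<and> n t = 0"
      then have "AE t in M. t \<in> ball x e \<longrightarrow> p t = 0" "AE t in M. t \<in> ball x e \<longrightarrow> n t = 0"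
        by (auto elim: eventually_mono)
      then have "emeasure sp (ball x e) = 0" "emeasure sn (ball x e) = 0"
        using emeasure_density_eq_0[OF sM p(1,2), of "ball x e"] emeasure_density_eq_0[OF sM n(1,2), of "ball x e"]
        by (auto simp flip: p(3) n(3))
      moreover have "x \<in> rsupp a b sp sn" using H3(2) x by simp
      ultimately show False using x(2) unfolding rsupp_def msupp_def by fastforce
    qed
  qed (use ab r p n p' n' in \<open>auto intro!: density_locint lf simp flip: r(3) p(3) n(3) p'(3) n'(3)\<close>)
  show ?thesis
    using adjoint_T0_eq_Tmax unfolding r(3)[symmetric] p(3)[symmetric] n(3)[symmetric] p'(3)[symmetric] n'(3)[symmetric] .
qed

end
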